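(* Let $N$ be a finitely generated, semipositive, cancellative, reduced binoid and let $\mathfrak n$ be an $N_+$-primary ideal of $N$. Then the Hilbert–Kunz multiplicity $e_{HK}(\mathfrak n,N)=\lim_{q\to\infty}\operatorname{HKF}(\mathfrak n,N,q)/q^{\dim N}$ exists and is a rational number.
   Context: A binoid $(N,+,0,\infty)$ is a commutative monoid $(N,+,0)$ with an element $\infty$ satisfying $a+\infty=\infty$ for all $a\in N$. Write $N^\bullet=N\setminus\{\infty\}$, $N^\times$ for the group of units of $N$ and $N_+=N\setminus N^\times$. $N$ is finitely generated if it is finitely generated as a monoid; semipositive if $N\neq\{\infty\}$ and $N^\times$ is finite; positive if $N\neq\{\infty\}$ and $N^\times=\{0\}$. An ideal of $N$ is a nonempty subset $I\subseteq N$ with $I+N\subseteq I$ (so $\infty\in I$). For an ideal $I$ and $q\in\mathbb N_+$, $[q]I$ denotes the ideal generated by $\{qa: a\in I\}$. An ideal $\mathfrak n$ is $N_+$-primary if $\mathfrak n\subseteq N_+$ and for every $a\in N_+$ there is $k\ge1$ with $ka\in\mathfrak n$. The residue class binoid $N/I$ is $(N\setminus I)\cup\{\infty\}$, with $[a]+[b]=[a+b]$ if $a+b\notin I$ and $=\infty$ otherwise. A prime ideal is an ideal $\mathfrak p\neq N$ such that $a+b\in\mathfrak p$ implies $a\in\mathfrak p$ or $b\in\mathfrak p$; the (combinatorial) dimension $\dim N$ is the supremum of the lengths $k$ of chains $\mathfrak p_0\subsetneq\cdots\subsetneq\mathfrak p_k$ of prime ideals. An element $a$ is nilpotent if $ka=\infty$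 for some $k\ge1$; $N$ is reduced if $\infty$ is its only nilpotent element. $N$ is integral if $N\neq\{\infty\}$ and $a+b=\infty$ implies $a=\infty$ or $b=\infty$. $N$ is cancellative if $a+b=a+c\neq\infty$ implies $b=c$. $N$ is torsion-free if $ka=kb$ with $k\ge1$ implies $a=b$, and torsion-free up to nilpotence if $ka=kb\neq\infty$ with $k\ge1$ implies $a=b$. An $N$-set is a pointed set $(S,p)$ with a map $N\times S\to S$, $(n,s)\mapsto n+s$, such that $(n+m)+s=n+(m+s)$, $0+s=s$, $\infty+s=p$ and $n+p=p$. It is finitely generated if there are $s_1,\dots,s_r\in S$ with $S=\bigcup_j (N+s_j)$. $N$ itself and $N/I$ are $N$-sets with distinguished point $\infty$. For an ideal $J$ and an $N$-set $T$, $J+T=\{a+t:a\in J,t\in T\}$ is an $N$-subset; for an $N$-subset $S\subseteq T$ (a subset containing $p$ and stable under the action), the quotient $T/S$ is the $N$-set $(T\setminus S)\cup\{p\}$ (with $S$ collapsed to the point). For a finite pointed set $S$ we write $\#S=|S|-1$. For $N$ finitely generated and semipositive, $T$ a finitely generated $N$-set, $\mathfrak n$ an $N_+$-primary ideal and $q\in\mathbb N_+$, the Hilbert–Kunz function is $\operatorname{HKF}(\mathfrak n,T,q)=\#\,T/([q]\mathfrak n+T)$ (this set is finite), and $\operatorname{HKF}(N,q):=\operatorname{HKF}(N_+,N,q)=\#N/[q]N_+$. The Hilbert–Kunz multiplicity is $e_{HK}(\mathfrak n,T)=\lim_{q\to\infty}\operatorname{HKF}(\mathfrak n,T,q)/q^{\dim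 N}$, the limit taken over all positive integers $q$, when it exists; $e_{HK}(N):=e_{HK}(N_+,N)$. *)

theory Defs
  imports "HOL-Analysis.Analysis"
begin

record 'a binoid =
  bcarrier :: "'a set"
  bplus :: "'a \<Rightarrow> 'a \<Rightarrow> 'a"
  bzero :: 'a
  binf :: 'a

definition is_binoid :: "'a binoid \<Rightarrow> bool" where
  "is_binoid B \<longleftrightarrow>
     (\<forall>a\<in>bcarrier B. \<forall>b\<in>bcarrier B. bplus B a b \<in> bcarrier B) \<and>
     (\<forall>a\<in>bcarrier B. \<forall>b\<in>bcarrier B. \<forall>c\<in>bcarrier B.
        bplus B (bplus B a b) c = bplus B a (bplus B b c)) \<and>
     (\<forall>a\<in>bcarrier B. \<forall>b\<in>bcarrier B. bplus B a b = bplus B b a) \<and>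
     bzero B \<in> bcarrier B \<and> (\<forall>a\<in>bcarrier B. bplus B (bzero B) a = a) \<and>
     binf B \<in> bcarrier B \<and> (\<forall>a\<in>bcarrier B. bplus B a (binf B) = binf B)"

definition bmult :: "'a binoid \<Rightarrow> nat \<Rightarrow> 'a \<Rightarrow> 'a" where
  "bmult B k a = (bplus B a ^^ k) (bzero B)"

inductive_set bgen :: "'a binoid \<Rightarrow> 'a set \<Rightarrow> 'a set" for B G where
  zero: "bzero B \<in> bgen B G"
| gen: "g \<in> G \<Longrightarrow> g \<in> bgen B G"
| plus: "a \<in> bgen B G \<Longrightarrow> b \<in> bgen B G \<Longrightarrow> bplus B a b \<in> bgen B G"

definition fin_gen :: "'a binoid \<Rightarrow> bool" where
  "fin_gen B \<longleftrightarrow> (\<exists>G. finite G \<and> G \<subseteq> bcarrier B \<and> bgen B G = bcarrier B)"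

definition bunits :: "'a binoid \<Rightarrow> 'a set" where
  "bunits B = {a\<in>bcarrier B. \<exists>b\<in>bcarrier B. bplus B a b = bzero B}"

definition bpos_part :: "'a binoid \<Rightarrow> 'a set" where
  "bpos_part B = bcarrier B - bunits B"

definition semipositive :: "'a binoid \<Rightarrow> bool" where
  "semipositive B \<longleftrightarrow> bcarrier B \<noteq> {binf B} \<and> finite (bunits B)"

definition cancellative :: "'a binoid \<Rightarrow> bool" where
  "cancellative B \<longleftrightarrow> (\<forall>a\<in>bcarrier B. \<forall>b\<in>bcarrier B. \<forall>c\<in>bcarrier B.
      bplus B a b = bplus B a c \<and> bplus B a b \<noteq> binf B \<longrightarrow> b = c)"

definition nilpotent :: "'a binoid \<Rightarrow> 'a \<Rightarrow> bool" where
  "nilpotent B a \<longleftrightarrow> (\<exists>k\<ge>1. bmult B k a = binf B)"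

definition breduced :: "'a binoid \<Rightarrow> bool" where
  "breduced B \<longleftrightarrow> (\<forall>a\<in>bcarrier B. nilpotent B a \<longrightarrow> a = binf B)"

definition bideal :: "'a binoid \<Rightarrow> 'a set \<Rightarrow> bool" where
  "bideal B I \<longleftrightarrow> I \<noteq> {} \<and> I \<subseteq> bcarrier B \<and>
     (\<forall>a\<in>I. \<forall>n\<in>bcarrier B. bplus B a n \<in> I)"

definition primary_ideal :: "'a binoid \<Rightarrow> 'a set \<Rightarrow> bool" where
  "primary_ideal B I \<longleftrightarrow> bideal B I \<and> I \<subseteq> bpos_part B \<and>
     (\<forall>a\<in>bpos_part B. \<exists>k\<ge>1. bmult B k a \<in> I)"

definition prime_ideal :: "'a binoid \<Rightarrow> 'a set \<Rightarrow> bool" where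
  "prime_ideal B P \<longleftrightarrow> bideal B P \<and> P \<noteq> bcarrier B \<and>
     (\<forall>a\<in>bcarrier B. \<forall>b\<in>bcarrier B. bplus B a b \<in> P \<longrightarrow> a \<in> P \<or> b \<in> P)"

definition bdim :: "'a binoid \<Rightarrow> enat" where
  "bdim B = Sup {enat k | k. \<exists>P :: nat \<Rightarrow> 'a set.
       (\<forall>i\<le>k. prime_ideal B (P i)) \<and> (\<forall>i<k. P i \<subset> P (Suc i))}"

definition bsum :: "'a binoid \<Rightarrow> 'a set \<Rightarrow> 'a set \<Rightarrow> 'a set" where
  "bsum B J T = {bplus B a t | a t. a \<in> J \<and> t \<in> T}"

definition frob_ideal :: "'a binoid \<Rightarrow> nat \<Rightarrow> 'a set \<Rightarrow> 'a set" where
  "frob_ideal B q I = bsum B {bmult B q a | a. a \<in> I} (bcarrier B)"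

text \<open>HKF(n, N, q) = # N/([q]n + N) = number of non-distinguished points of the quotient,
  i.e. the cardinality of N minus ([q]n + N).\<close>
definition HKF :: "'a binoid \<Rightarrow> 'a set \<Rightarrow> nat \<Rightarrow> nat" where
  "HKF B I q = card (bcarrier B - bsum B (frob_ideal B q I) (bcarrier B))"

end

theory Submission
  imports Defs "HOL-Computational_Algebra.Polynomial_FPS"
begin

text \<open>
  Since the ideal is generated by finitely many \<open>f\<close>, the pairs \<open>(q, a)\<close> with \<open>a\<close> not in the
  \<open>q\<close>-th Frobenius ideal are what remains of a finitely generated graded submonoid of
  \<open>\<nat> \<times> N\<close> after removing the finitely generated submonoids
  \<open>{(q, qf + c)}\<close>. By Dickson's lemma and cancellation, intersections of finitely generated
  submonoids are finitely generated (away from infinity), so inclusion-exclusion together with a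
  combinatorial form of Hilbert's theorem makes the generating function of the Hilbert--Kunz function
  rational with poles at roots of unity. Hence, along the multiples of some \<open>m\<close>, the function is
  eventually a polynomial with rational coefficients. Noetherian induction over ideals bounds its
  growth by \<open>q ^ dim N\<close>, and monotonicity in \<open>q\<close> extends the limit from the multiples of \<open>m\<close>
  to all \<open>q\<close>.
\<close>

unbundle no vec_syntax
unbundle fps_syntax

section \<open>Integer sequences with rational generating function\<close>

text \<open>The obstacle is finiteness in each degree: the monoid of all pairs \<open>(q, a)\<close>
  has a whole copy of the binoid in degree 0, so its degree pieces cannot be counted. The remedy is
  a linear length bound. Some multiple of each nonunit generator lies in the ideal, so an element
  outside the \<open>q\<close>-th Frobenius ideal is a sum of at most \<open>q * K\<close>
  generators, hence a sum of \<open>q\<close> members of one finite set placed in degree 1. That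
  finite set generates the ambient graded monoid; the other submonoids enter only through
  intersections with it, whose nonzero elements have positive degree again.

  Cancellation acts twice. It makes the difference of two relations a relation, so intersections are
  finitely generated, and it makes adding a generator injective away from infinity, so that Hilbert
  series are merely shifted.

  Rationality of the generating function says nothing about the order of the pole at 1. The growth
  bound forces all coefficients above degree \<open>d\<close> to vanish; the one in degree
  \<open>d\<close> is an integer over \<open>d!\<close>. An upper bound is enough, because a limit 0
  is rational too.\<close>

definition rational_gf :: "int fps \<Rightarrow> bool" where
  "rational_gf F \<longleftrightarrow> (\<exists>m\<ge>1. \<exists>D p. F * (1 - fps_X ^ m) ^ D = fps_of_poly p)"

text \<open>By the geometric sum, passing from \<open>m\<close> to a multiple costs only a
  polynomial factor. Two series can thus be brought to one denominator, which is why
  \<open>rational_gf\<close> uses a single modulus \<open>m\<close> instead of a product of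
  different factors.\<close>

lemma one_minus_X_power_dvd:
  "\<exists>p. (1 - fps_X ^ (m * k)) ^ D = (1 - fps_X ^ m :: int fps) ^ D * fps_of_poly p"
proof -
  have "(1 - fps_X ^ (m * k) :: int fps) = (1 - fps_X ^ m) * (\<Sum>i<k. (fps_X ^ m) ^ i)"
    by (simp add: power_mult one_diff_power_eq)
  also have "(\<Sum>i<k. (fps_X ^ m) ^ i) = fps_of_poly (\<Sum>i<k. monom (1::int) (m * i))"
    by (simp add: fps_of_poly_sum fps_of_poly_monom' power_mult)
  finally show ?thesis
    by (metis power_mult_distrib fps_of_poly_power)
qed

lemma rational_gf_lift:
  fixes F :: "int fps"
  assumes "F * (1 - fps_X ^ m) ^ D = fps_of_poly p" and "D \<le> D'"
  shows "\<exists>p'. F * (1 - fps_X ^ (m * k)) ^ D' = fps_of_poly p'"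
proof -
  obtain r where r: "(1 - fps_X ^ (m * k)) ^ D = (1 - fps_X ^ m :: int fps) ^ D * fps_of_poly r"
    using one_minus_X_power_dvd by blast
  have "(1 - fps_X ^ (m * k) :: int fps) = fps_of_poly (1 - monom 1 (m * k))"
    by (simp add: fps_of_poly_diff fps_of_poly_monom')
  then have "(1 - fps_X ^ (m * k) :: int fps) ^ (D' - D) = fps_of_poly ((1 - monom 1 (m * k)) ^ (D' - D))"
    by (simp only: fps_of_poly_power)
  moreover have "(1 - fps_X ^ (m * k) :: int fps) ^ D' =
      (1 - fps_X ^ (m * k)) ^ D * (1 - fps_X ^ (m * k)) ^ (D' - D)"
    using assms(2) by (metis le_add_diff_inverse power_add)
  ultimately have "F * (1 - fps_X ^ (m * k)) ^ D' =
      (F * (1 - fps_X ^ m) ^ D) * (fps_of_poly r * fps_of_poly ((1 - monom 1 (m * k)) ^ (D' - D)))"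
    using r by (simp add: mult_ac)
  then show ?thesis
    using assms(1) by (metis fps_of_poly_mult)
qed

lemma rational_gf_common:
  assumes "rational_gf F" and "rational_gf G"
  obtains m D p r where "m \<ge> 1" "F * (1 - fps_X ^ m) ^ D = fps_of_poly p"
    "G * (1 - fps_X ^ m) ^ D = fps_of_poly r"
proof -
  obtain m D p where 1: "m \<ge> 1" "F * (1 - fps_X ^ m) ^ D = fps_of_poly p"
    using assms(1) unfolding rational_gf_def by blast
  obtain m' D' p' where 2: "m' \<ge> 1" "G * (1 - fps_X ^ m') ^ D' = fps_of_poly p'"
    using assms(2) unfolding rational_gf_def by blast
  obtain s where "F * (1 - fps_X ^ (m * m')) ^ max D D' = fps_of_poly s"
    using rational_gf_lift[OF 1(2), of "max D D'" m'] by auto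
  moreover obtain t where "G * (1 - fps_X ^ (m * m')) ^ max D D' = fps_of_poly t"
    using rational_gf_lift[OF 2(2), of "max D D'" m] by (auto simp: mult.commute)
  moreover have "m * m' \<ge> 1"
    using 1 2 by simp
  ultimately show thesis
    using that by blast
qed

lemma rational_gf_diff:
  assumes "rational_gf F" and "rational_gf G"
  shows "rational_gf (F - G)"
  by (rule rational_gf_common[OF assms])
    (metis rational_gf_def left_diff_distrib fps_of_poly_diff)

lemma rational_gf_X_power_mult:
  assumes "rational_gf F"
  shows "rational_gf (fps_X ^ d * F)"
  using assms unfolding rational_gf_def
  by (metis (no_types, lifting) fps_of_poly_monom' fps_of_poly_mult mult.assoc)

lemma rational_gf_poly: "rational_gf (fps_of_poly p)"
  unfolding rational_gf_def by (intro exI[of _ 1] conjI exI[of _ 0] exI[of _ p]) auto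

text \<open>Divides by the factor that a generator of degree \<open>d\<close> contributes to a
  Hilbert series. Both \<open>1 - fps_X ^ d\<close> and \<open>1 - fps_X ^ m\<close> divide
  \<open>1 - fps_X ^ (m * d)\<close>, so one extra power of the latter absorbs the new
  factor.\<close>

lemma rational_gf_cancel:
  assumes "rational_gf (F * (1 - fps_X ^ d))" and "d \<ge> 1"
  shows "rational_gf F"
proof -
  obtain m D p where m: "m \<ge> 1" "F * (1 - fps_X ^ d) * (1 - fps_X ^ m) ^ D = fps_of_poly p"
    using assms(1) unfolding rational_gf_def by blast
  obtain r where r: "(1 - fps_X ^ (d * m)) ^ 1 = (1 - fps_X ^ d :: int fps) ^ 1 * fps_of_poly r"
    using one_minus_X_power_dvd by blast
  obtain s where s: "(1 - fps_X ^ (m * d)) ^ D = (1 - fps_X ^ m :: int fps) ^ D * fps_of_poly s"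
    using one_minus_X_power_dvd by blast
  have "F * (1 - fps_X ^ (m * d)) ^ Suc D =
      (F * (1 - fps_X ^ d) * (1 - fps_X ^ m) ^ D) * (fps_of_poly r * fps_of_poly s)"
    using r s by (simp add: mult_ac)
  then have "F * (1 - fps_X ^ (m * d)) ^ Suc D = fps_of_poly (p * (r * s))"
    using m by (simp add: fps_of_poly_mult)
  moreover have "m * d \<ge> 1"
    using m assms by simp
  ultimately show ?thesis
    unfolding rational_gf_def by blast
qed

text \<open>Multiplication by \<open>1 - fps_X ^ m\<close> combines only coefficients whose indices
  agree modulo \<open>m\<close>, so on the multiples of \<open>m\<close> it acts as
  \<open>1 - fps_X\<close>. This turns all roots of unity in the denominator into the single pole
  1.\<close>

lemma fps_section_mult_one_minus_X:
  fixes F :: "int fps"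
  assumes "m \<ge> 1"
  shows "Abs_fps (\<lambda>k. (F * (1 - fps_X ^ m) ^ D) $ (m * k)) = Abs_fps (\<lambda>k. F $ (m * k)) * (1 - fps_X) ^ D"
proof (induction D arbitrary: F)
  case 0
  show ?case by simp
next
  case (Suc D)
  have split: "F * (1 - fps_X ^ m) ^ Suc D = (F * (1 - fps_X ^ m)) * (1 - fps_X ^ m) ^ D"
    by (simp add: mult_ac)
  have one: "Abs_fps (\<lambda>k. (F * (1 - fps_X ^ m)) $ (m * k)) = Abs_fps (\<lambda>k. F $ (m * k)) * (1 - fps_X)"
  proof (rule fps_ext)
    fix k
    have *: "m * k < m \<longleftrightarrow> k = 0"
      using assms by simp
    have "m * k - m = m * (k - 1)"
      by (simp add: algebra_simps)
    then show "Abs_fps (\<lambda>k. (F * (1 - fps_X ^ m)) $ (m * k)) $ k = (Abs_fps (\<lambda>k. F $ (m * k)) * (1 - fps_X)) $ k"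
      using fps_X_power_mult_right_nth[of "Abs_fps (\<lambda>k. F $ (m * k))" 1 k] assms
      by (auto simp: right_diff_distrib fps_X_power_mult_right_nth *)
  qed
  show ?case
    unfolding split Suc.IH one by (simp add: mult_ac)
qed

text \<open>Multiplication by \<open>1 - fps_X\<close> is the backward difference, so each step sums
  a sequence that is already a combination of binomials. In the binomial basis summation raises
  indices and keeps coefficients integral; \<open>k0\<close> only skips the degrees of
  \<open>p\<close>.\<close>

lemma eventually_binomial_sum:
  fixes G :: "int fps"
  assumes "G * (1 - fps_X) ^ D = fps_of_poly p"
  shows "\<exists>k0 a. \<forall>k. G $ (k0 + k) = (\<Sum>i<D. a i * int (k choose i))"
  using assms
proof (induction D arbitrary: G)
  case 0
  then have "G = fps_of_poly p" by simp
  then have "\<forall>k. G $ (Suc (degree p) + k) = 0"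
    by (simp add: coeff_eq_0)
  then show ?case
    by (intro exI[of _ "Suc (degree p)"]) simp
next
  case (Suc D)
  have "(G * (1 - fps_X)) * (1 - fps_X) ^ D = fps_of_poly p"
    using Suc.prems by (simp add: mult_ac)
  then obtain k0 a where a: "\<And>k. (G * (1 - fps_X)) $ (k0 + k) = (\<Sum>i<D. a i * int (k choose i))"
    using Suc.IH by blast
  have step: "G $ (k0 + Suc k) - G $ (k0 + k) = (\<Sum>i<D. a i * int (Suc k choose i))" for k
    using a[of "Suc k"] fps_X_power_mult_right_nth[of G 1 "k0 + Suc k"]
    by (simp add: right_diff_distrib)
  \<comment> \<open>By Pascal's rule the increment has coefficients \<open>a i + a (Suc i)\<close>
    at \<open>k choose i\<close>, with \<open>a D\<close> read as 0. Its discrete antiderivative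
    moves them up by one index, and the constant term is the initial value.\<close>
  define b where "b i = (if i = 0 then G $ k0 else a (i - 1) + (if i < D then a i else 0))" for i
  have "G $ (k0 + k) = (\<Sum>i<Suc D. b i * int (k choose i))" for k
  proof (induction k)
    case 0
    show ?case by (simp add: sum.lessThan_Suc_shift b_def del: sum.lessThan_Suc)
  next
    case (Suc k)
    have "(\<Sum>i<Suc D. b i * int (Suc k choose i)) - (\<Sum>i<Suc D. b i * int (k choose i))
       = (\<Sum>i<D. b (Suc i) * int (k choose i))"
      by (simp add: sum.lessThan_Suc_shift algebra_simps sum.distrib del: sum.lessThan_Suc)
    also have "\<dots> = (\<Sum>i<D. a i * int (k choose i)) + (\<Sum>i<D. (if Suc i < D then a (Suc i) else 0) * int (k choose i))"
      by (simp add: b_def algebra_simps sum.distrib)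
    also have "(\<Sum>i<D. (if Suc i < D then a (Suc i) else 0) * int (k choose i)) =
        (\<Sum>i<D. (if i = 0 then 0 else a i * int (k choose (i - 1))))"
    proof (cases D)
      case (Suc E)
      show ?thesis unfolding Suc
        by (subst sum.lessThan_Suc, subst sum.lessThan_Suc_shift) simp
    qed simp
    also have "(\<Sum>i<D. a i * int (k choose i)) + \<dots> = (\<Sum>i<D. a i * int (Suc k choose i))"
      unfolding sum.distrib[symmetric]
      by (rule sum.cong) (auto simp: algebra_simps choose_reduce_nat)
    finally show ?case
      using step[of k] Suc by linarith
  qed
  then show ?case by blast
qed

section \<open>Limits of integer combinations of binomial coefficients\<close>

lemma binomial_quotient_limit:
  "(\<lambda>k. real (k choose i) / real k ^ i) \<longlonglongrightarrow> 1 / fact i"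
proof -
  have "(\<lambda>k. (\<Prod>j<i. 1 - real j / real k) / fact i) \<longlonglongrightarrow> (\<Prod>j<i. 1 - 0) / fact i"
    by (intro tendsto_divide tendsto_prod tendsto_diff tendsto_const lim_const_over_n) simp
  then have lim: "(\<lambda>k. (\<Prod>j<i. 1 - real j / real k) / fact i) \<longlonglongrightarrow> 1 / fact i"
    by simp
  have "real (k choose i) / real k ^ i = (\<Prod>j<i. 1 - real j / real k) / fact i" if "k \<ge> 1" for k
  proof -
    have "real (k choose i) / real k ^ i = (\<Prod>j<i. real k - real j) / (\<Prod>j<i. real k) / fact i"
      by (simp add: binomial_gbinomial gbinomial_prod_rev atLeast0LessThan mult.commute)
    also have "(\<Prod>j<i. real k - real j) / (\<Prod>j<i. real k) = (\<Prod>j<i. 1 - real j / real k)"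
      unfolding prod_dividef[symmetric] by (rule prod.cong) (use that in \<open>auto simp: field_simps\<close>)
    finally show ?thesis .
  qed
  then have "\<forall>\<^sub>F k in sequentially. (\<Prod>j<i. 1 - real j / real k) / fact i = real (k choose i) / real k ^ i"
    by (intro eventually_sequentiallyI[of 1]) simp
  then show ?thesis
    using lim tendsto_cong by force
qed

lemma shifted_power_quotient_limit:
  assumes "i \<le> d"
  shows "(\<lambda>k. real k ^ i / real (k0 + k) ^ d) \<longlonglongrightarrow> (if i = d then 1 else 0)"
proof -
  have 2: "(\<lambda>k. 1 / real (k0 + k)) \<longlonglongrightarrow> 0"
    using LIMSEQ_ignore_initial_segment[OF lim_const_over_n[of 1], of k0] by (simp add: add.commute)
  have "(\<lambda>k. 1 - real k0 * (1 / real (k0 + k))) \<longlonglongrightarrow> 1 - real k0 * 0"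
    by (intro tendsto_intros 2)
  moreover have "\<forall>\<^sub>F k in sequentially. 1 - real k0 * (1 / real (k0 + k)) = real k / real (k0 + k)"
    by (intro eventually_sequentiallyI[of 1]) (simp add: field_simps)
  ultimately have 1: "(\<lambda>k. real k / real (k0 + k)) \<longlonglongrightarrow> 1"
    using Lim_transform_eventually by fastforce
  have "(\<lambda>k. (real k / real (k0 + k)) ^ i * (1 / real (k0 + k)) ^ (d - i)) \<longlonglongrightarrow> 1 ^ i * 0 ^ (d - i)"
    by (intro tendsto_intros 1 2)
  moreover have "(real k / real (k0 + k)) ^ i * (1 / real (k0 + k)) ^ (d - i) = real k ^ i / real (k0 + k) ^ d" for k
    using assms by (simp add: power_divide flip: power_add)
  moreover have "(1::real) ^ i * 0 ^ (d - i) = (if i = d then 1 else 0)"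
    using assms by auto
  ultimately show ?thesis by simp
qed

text \<open>Induction from the top coefficient. If the top index exceeds \<open>d\<close>, dividing
  by the power with that index sends the sum both to the coefficient over a factorial and, by the
  bound, to 0, so the coefficient vanishes. Once the top index is at most \<open>d\<close>, only
  index \<open>d\<close> can survive in the limit.\<close>

lemma binomial_sum_limit:
  fixes a :: "nat \<Rightarrow> int"
  assumes "\<And>k. k \<ge> 1 \<Longrightarrow> \<bar>\<Sum>i<D. real_of_int (a i) * real (k choose i)\<bar> \<le> K * real (k0 + k) ^ d"
  shows "\<exists>e\<in>\<rat>. (\<lambda>k. (\<Sum>i<D. real_of_int (a i) * real (k choose i)) / real (k0 + k) ^ d) \<longlonglongrightarrow> e"
  using assms
proof (induction D)
  case 0
  show ?case by (auto intro!: bexI[of _ 0])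
next
  case (Suc D)
  have quot: "real (k choose i) / real (k0 + k) ^ d =
      (real (k choose i) / real k ^ i) * (real k ^ i / real (k0 + k) ^ d)" if "k \<ge> 1" for k i d
    using that by simp
  have lim: "(\<lambda>k. real (k choose i) / real (k0 + k) ^ d) \<longlonglongrightarrow> 1 / fact i * (if i = d then 1 else 0)"
    if "i \<le> d" for i d
    by (rule Lim_transform_eventually[OF tendsto_mult[OF binomial_quotient_limit
            shifted_power_quotient_limit[OF that]]])
      (auto intro!: eventually_sequentiallyI[of 1])
  have sumlim: "(\<lambda>k. (\<Sum>i<Suc D. real_of_int (a i) * real (k choose i)) / real (k0 + k) ^ d) \<longlonglongrightarrow>
      (\<Sum>i<Suc D. real_of_int (a i) * (1 / fact i * (if i = d then 1 else 0)))" if "D \<le> d" for d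
    unfolding sum_divide_distrib times_divide_eq_right[symmetric]
    by (intro tendsto_sum tendsto_mult tendsto_const lim) (use that in auto)
  show ?case
  proof (cases "D \<le> d")
    case True
    have "(\<Sum>i<Suc D. real_of_int (a i) * (1 / fact i * (if i = d then 1 else 0))) \<in> \<rat>"
    proof -
      have "fact i = (of_nat (fact i) :: real)" for i
        by simp
      then have "(fact i :: real) \<in> \<rat>" for i
        by (metis Rats_of_nat)
      then show ?thesis
        by (intro Rats_sum Rats_mult Rats_divide) auto
    qed
    then show ?thesis
      using sumlim[OF True] by blast
  next
    case False
    have "(\<Sum>i<D. real_of_int (a i) * (1 / fact i * (if i = D then 1 else 0))) = 0"
      by (rule sum.neutral) simp
    then have "(\<lambda>k. (\<Sum>i<Suc D. real_of_int (a i) * real (k choose i)) / real (k0 + k) ^ D) \<longlonglongrightarrow> real_of_int (a D) / fact D"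
      using sumlim[of D] by simp
    moreover have "(\<lambda>k. (\<Sum>i<Suc D. real_of_int (a i) * real (k choose i)) / real (k0 + k) ^ D) \<longlonglongrightarrow> 0"
    proof (rule tendsto_0_le[where K = 1])
      show "(\<lambda>k. K * (1 / real (k0 + k)) ^ (D - d)) \<longlonglongrightarrow> 0"
      proof -
        have "(\<lambda>k. 1 / real (k0 + k)) \<longlonglongrightarrow> 0"
          using LIMSEQ_ignore_initial_segment[OF lim_const_over_n[of 1], of k0] by (simp add: add.commute)
        from tendsto_mult[OF tendsto_const[of K] tendsto_power[OF this, of "D - d"]]
        show ?thesis using False by (simp add: power_0_left)
      qed
      show "\<forall>\<^sub>F k in sequentially. norm ((\<Sum>i<Suc D. real_of_int (a i) * real (k choose i)) / real (k0 + k) ^ D)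
          \<le> norm (K * (1 / real (k0 + k)) ^ (D - d)) * 1"
      proof (rule eventually_sequentiallyI[of 1])
        fix k :: nat assume k: "1 \<le> k"
        have "norm ((\<Sum>i<Suc D. real_of_int (a i) * real (k choose i)) / real (k0 + k) ^ D)
          \<le> K * real (k0 + k) ^ d / real (k0 + k) ^ D"
          using Suc.prems[OF k] by (simp add: divide_right_mono del: sum.lessThan_Suc)
        also have "\<dots> = K * (1 / real (k0 + k)) ^ (D - d)"
          using False k by (simp add: power_divide field_simps flip: power_add)
        also have "\<dots> \<le> norm (K * (1 / real (k0 + k)) ^ (D - d)) * 1"
          by simp
        finally show "norm ((\<Sum>i<Suc D. real_of_int (a i) * real (k choose i)) / real (k0 + k) ^ D)
          \<le> norm (K * (1 / real (k0 + k)) ^ (D - d)) * 1" .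
      qed
    qed
    ultimately have "a D = 0"
      using LIMSEQ_unique by fastforce
    then show ?thesis
      using Suc by simp
  qed
qed

text \<open>The sequence itself is eventually only a quasi-polynomial, with one polynomial for each
  residue class modulo \<open>m\<close>; hence the limit along multiples of
  \<open>m\<close>.\<close>

lemma rational_gf_section_limit:
  fixes f :: "nat \<Rightarrow> nat"
  assumes "rational_gf (Abs_fps (\<lambda>q. int (f q)))"
    and bound: "\<And>q. q \<ge> 1 \<Longrightarrow> real (f q) \<le> K * real q ^ d"
  shows "\<exists>m\<ge>1. \<exists>e\<in>\<rat>. (\<lambda>k. real (f (m * k)) / real k ^ d) \<longlonglongrightarrow> e"
proof -
  define F where "F = Abs_fps (\<lambda>q. int (f q))"
  obtain m D p where m: "m \<ge> 1" and F: "F * (1 - fps_X ^ m) ^ D = fps_of_poly p"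
    using assms(1) unfolding rational_gf_def F_def by blast
  define G where "G = Abs_fps (\<lambda>k. F $ (m * k))"
  \<comment> \<open>The section of the numerator \<open>p\<close>; summing up to
    \<open>degree p\<close> is enough because \<open>m * k \<ge> k\<close>.\<close>
  define r where "r = (\<Sum>k\<le>degree p. monom (coeff p (m * k)) k)"
  have "G * (1 - fps_X) ^ D = fps_of_poly r"
  proof -
    have "coeff p (m * k) = 0" if "k > degree p" for k
    proof (rule coeff_eq_0)
      have "k \<le> m * k"
        using m by simp
      then show "degree p < m * k"
        using that by linarith
    qed
    then have "coeff r k = coeff p (m * k)" for k
      by (cases "k \<le> degree p") (auto simp: r_def coeff_sum)
    then show ?thesis
      using fps_section_mult_one_minus_X[OF m, of F D] unfolding G_def F
      by (metis (no_types, lifting) fps_ext fps_nth_Abs_fps fps_of_poly_nth)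
  qed
  then obtain k0 a where a: "\<And>k. G $ (k0 + k) = (\<Sum>i<D. a i * int (k choose i))"
    using eventually_binomial_sum by blast
  have fa: "real (f (m * (k0 + k))) = (\<Sum>i<D. real_of_int (a i) * real (k choose i))" for k
  proof -
    have "real (f (m * (k0 + k))) = real_of_int (G $ (k0 + k))"
      by (simp add: G_def F_def)
    then show ?thesis
      by (simp add: a)
  qed
  have "\<bar>\<Sum>i<D. real_of_int (a i) * real (k choose i)\<bar> \<le> (K * real m ^ d) * real (k0 + k) ^ d"
    if "k \<ge> 1" for k
    using bound[of "m * (k0 + k)"] m that fa[of k, symmetric] by (simp add: power_mult_distrib mult.assoc)
  then obtain e where e: "e \<in> \<rat>"
    "(\<lambda>k. (\<Sum>i<D. real_of_int (a i) * real (k choose i)) / real (k0 + k) ^ d) \<longlonglongrightarrow> e"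
    using binomial_sum_limit by blast
  have "(\<lambda>k. real (f (m * (k + k0))) / real (k + k0) ^ d) \<longlonglongrightarrow> e"
    using e(2) fa by (simp add: add.commute[of k0])
  then have "(\<lambda>k. real (f (m * k)) / real k ^ d) \<longlonglongrightarrow> e"
    by (rule LIMSEQ_offset)
  then show ?thesis
    using m e(1) by blast
qed

section \<open>Graded commutative monoids, cancellative outside an absorbing set\<close>

text \<open>Let \<open>T\<close> dominate \<open>S\<close> on the smaller index set and let
  \<open>m\<close> be the largest new coordinate occurring in \<open>T\<close>. Elements with new
  coordinate at least \<open>m\<close> are dominated by \<open>T\<close>; the others fall into
  finitely many slices with that coordinate fixed, and the induction hypothesis applies to each
  slice.\<close>

lemma dickson:
  fixes S :: "('i \<Rightarrow> nat) set"
  assumes "finite I"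
  shows "\<exists>T\<subseteq>S. finite T \<and> (\<forall>s\<in>S. \<exists>t\<in>T. \<forall>i\<in>I. t i \<le> s i)"
  using assms
proof (induction I arbitrary: S)
  case empty
  show ?case
  proof (cases "S = {}")
    case False
    then obtain s where "s \<in> S" by blast
    then show ?thesis
      by (intro exI[of _ "{s}"]) auto
  qed auto
next
  case (insert i I)
  obtain T where T: "T \<subseteq> S" "finite T" "\<And>s. s \<in> S \<Longrightarrow> \<exists>t\<in>T. \<forall>j\<in>I. t j \<le> s j"
    using insert.IH[of S] by blast
  define A where "A v = {s\<in>S. s i = v}" for v
  have "\<forall>v. \<exists>T'. T' \<subseteq> A v \<and> finite T' \<and> (\<forall>s\<in>A v. \<exists>t\<in>T'. \<forall>j\<in>I. t j \<le> s j)"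
    by (intro allI insert.IH)
  from choice[OF this] obtain U where
    U0: "\<forall>v. U v \<subseteq> A v \<and> finite (U v) \<and> (\<forall>s\<in>A v. \<exists>t\<in>U v. \<forall>j\<in>I. t j \<le> s j)"
    by (rule exE)
  note U = U0[rule_format, THEN conjunct1] U0[rule_format, THEN conjunct2, THEN conjunct1]
    U0[rule_format, THEN conjunct2, THEN conjunct2, rule_format]
  define m where "m = Max ((\<lambda>t. t i) ` T)"
  define T' where "T' = T \<union> (\<Union>v\<in>{..<m}. U v)"
  have "\<exists>t\<in>T'. \<forall>j\<in>insert i I. t j \<le> s j" if s: "s \<in> S" for s
  proof (cases "s i < m")
    case True
    obtain t where t: "t \<in> U (s i)" "\<forall>j\<in>I. t j \<le> s j"
      using U(3)[of s "s i"] s by (auto simp: A_def)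
    moreover have "t i = s i"
      using t(1) U(1)[of "s i"] by (auto simp: A_def)
    ultimately show ?thesis
      using True unfolding T'_def by (intro bexI[of _ t]) auto
  next
    case False
    obtain t where t: "t \<in> T" "\<forall>j\<in>I. t j \<le> s j"
      using T(3)[OF s] by blast
    then have "t i \<le> m"
      unfolding m_def using T(2) by simp
    then show ?thesis
      using t False unfolding T'_def by (intro bexI[of _ t]) auto
  qed
  moreover have "U v \<subseteq> S" for v
    using U(1)[of v] unfolding A_def by blast
  then have "T' \<subseteq> S" "finite T'"
    using T U(2) unfolding T'_def by auto
  ultimately show ?case by blast
qed

text \<open>Interpreted twice: on the binoid itself with degree constantly 0, for the generation of
  ideals, and on pairs \<open>(q, a)\<close> graded by \<open>q\<close>, for counting.\<close>

locale graded_monoid = comm_monoid add zero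
  for add :: "'b \<Rightarrow> 'b \<Rightarrow> 'b" (infixl "\<oplus>" 65) and zero :: 'b ("\<zero>") +
  fixes Z :: "'b set" and deg :: "'b \<Rightarrow> nat"
  assumes Z_absorbing: "x \<in> Z \<Longrightarrow> x \<oplus> y \<in> Z"
    and cancel: "x \<oplus> y = x \<oplus> w \<Longrightarrow> x \<oplus> y \<notin> Z \<Longrightarrow> y = w"
    and deg_add: "deg (x \<oplus> y) = deg x + deg y"
begin

sublocale msum: comm_monoid_mset add zero ..

text \<open>Sums of multisets rather than an inductive closure: the count function of an expression
  is its exponent vector, to which Dickson's lemma applies.\<close>

definition gen :: "'b set \<Rightarrow> 'b set" where
  "gen X = {msum.F w | w. set_mset w \<subseteq> X}"

lemma genI: "set_mset w \<subseteq> X \<Longrightarrow> msum.F w \<in> gen X"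
  unfolding gen_def by blast

lemma genE:
  assumes "x \<in> gen X"
  obtains w where "set_mset w \<subseteq> X" "x = msum.F w"
  using assms unfolding gen_def by blast

lemma zero_in_gen: "\<zero> \<in> gen X"
  using genI[of "{#}"] by simp

lemma gen_base: "x \<in> X \<Longrightarrow> x \<in> gen X"
  using genI[of "{#x#}"] by simp

lemma gen_add: "x \<in> gen X \<Longrightarrow> y \<in> gen X \<Longrightarrow> x \<oplus> y \<in> gen X"
  by (elim genE) (auto intro!: genI simp flip: msum.union)

lemma gen_closed_subset:
  assumes "\<zero> \<in> M" and "\<And>x y. x \<in> M \<Longrightarrow> y \<in> X \<Longrightarrow> x \<oplus> y \<in> M"
  shows "gen X \<subseteq> M"
proof
  fix x assume "x \<in> gen X"
  then obtain w where "set_mset w \<subseteq> X" "x = msum.F w"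
    by (rule genE)
  then show "x \<in> M"
  proof (induction w arbitrary: x)
    case (add y w)
    then show ?case
      using assms(2)[of "msum.F w" y] by (simp add: commute)
  qed (use assms(1) in auto)
qed

lemma finite_gen_deg:
  assumes "finite Y" and "\<And>y. y \<in> Y \<Longrightarrow> deg y \<ge> 1"
  shows "finite {x \<in> gen Y. deg x = q}"
proof -
  have size_le: "size w \<le> deg (msum.F w)" if "set_mset w \<subseteq> Y" for w
    using that
  proof (induction w)
    case (add y w)
    then show ?case
      using assms(2)[of y] by (simp add: deg_add)
  qed simp
  have "{x \<in> gen Y. deg x = q} \<subseteq> msum.F ` (\<Union>n\<le>q. multisets_of_size Y n)"
    using size_le by (auto simp: gen_def multisets_of_size_def)
  then show ?thesis
    using assms(1) by (meson finite_UN_I finite_atMost finite_imageI finite_multisets_of_size finite_subset)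
qed

lemma count_le_imp_subseteq:
  assumes "set_mset w \<subseteq> X" and "\<And>x. x \<in> X \<Longrightarrow> count w x \<le> count v x"
  shows "w \<subseteq># v"
proof (rule mset_subset_eqI)
  show "count w x \<le> count v x" for x
    using assms by (cases "x \<in># w") (auto simp: not_in_iff)
qed

text \<open>The minimal exponent vectors among all expressions of elements of \<open>U\<close>
  provide the finite set; what remains of an expression after subtracting a minimal one is
  \<open>w\<close>.\<close>

lemma noetherian:
  assumes X: "finite X" and U: "U \<subseteq> gen X"
  shows "\<exists>T\<subseteq>U. finite T \<and> (\<forall>u\<in>U. \<exists>t\<in>T. \<exists>w. set_mset w \<subseteq> X \<and> u = t \<oplus> msum.F w)"
proof -
  define W where "W = {w. set_mset w \<subseteq> X \<and> msum.F w \<in> U}"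
  obtain T where T: "T \<subseteq> count ` W" "finite T" "\<And>s. s \<in> count ` W \<Longrightarrow> \<exists>t\<in>T. \<forall>i\<in>X. t i \<le> s i"
    using dickson[OF X, of "count ` W"] by blast
  obtain T' where T': "T' \<subseteq> W" "finite T'" "T = count ` T'"
    using T(1,2) by (meson finite_subset_image)
  have "\<exists>t\<in>msum.F ` T'. \<exists>w. set_mset w \<subseteq> X \<and> u = t \<oplus> msum.F w" if "u \<in> U" for u
  proof -
    have "u \<in> gen X"
      using U that by blast
    then obtain v where v: "set_mset v \<subseteq> X" "u = msum.F v"
      by (rule genE)
    then have "v \<in> W"
      using that unfolding W_def by simp
    then obtain t where t: "t \<in> T'" "\<forall>i\<in>X. count t i \<le> count v i"
      using T(3)[of "count v"] T'(3) by auto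
    then have "t \<subseteq># v"
      using T'(1) unfolding W_def by (intro count_le_imp_subseteq[of t X]) auto
    then obtain w where w: "v = t + w"
      by (metis subset_mset.le_iff_add)
    then show ?thesis
      using v t by (intro bexI[of _ "msum.F t"] exI[of _ w]) auto
  qed
  moreover have "msum.F ` T' \<subseteq> U"
    using T'(1) unfolding W_def by auto
  ultimately show ?thesis
    using T'(2) by (meson finite_imageI)
qed

text \<open>The pairs of expressions with a common value outside \<open>Z\<close> form a set that is closed under
  differences, by cancellation, and hence is generated by its minimal nonzero elements.\<close>

lemma finitely_generated_Int:
  assumes X: "finite X" and X': "finite X'"
  shows "\<exists>Y. finite Y \<and> gen Y - Z = gen X \<inter> gen X' - Z \<and> Y \<subseteq> gen X \<inter> gen X' - {\<zero>}"
proof -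
  define P where "P = {(v, w). set_mset v \<subseteq> X \<and> set_mset w \<subseteq> X' \<and> msum.F v = msum.F w \<and> msum.F v \<notin> Z}"
  define cnt :: "'b multiset \<times> 'b multiset \<Rightarrow> 'b + 'b \<Rightarrow> nat"
    where "cnt p = case_sum (count (fst p)) (count (snd p))" for p
  define P0 where "P0 = P - {({#}, {#})}"
  obtain T where T: "T \<subseteq> cnt ` P0" "finite T" "\<And>s. s \<in> cnt ` P0 \<Longrightarrow> \<exists>t\<in>T. \<forall>i\<in>X <+> X'. t i \<le> s i"
    using dickson[OF finite_Plus[OF X X'], of "cnt ` P0"] by blast
  obtain T' where T': "T' \<subseteq> P0" "finite T'" "T = cnt ` T'"
    using T(1,2) by (meson finite_subset_image)
  \<comment> \<open>A nonempty expression may sum to zero, for instance a unit plus its inverse.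
    Dropping such values does not change \<open>gen\<close>, and it lets later arguments conclude
    that all generators have positive degree.\<close>
  define Y where "Y = (msum.F \<circ> fst) ` T' - {\<zero>}"
  have "msum.F v \<in> gen Y" if "(v, w) \<in> P" for v w
    using that
  proof (induction "size v + size w" arbitrary: v w rule: less_induct)
    case less
    show ?case
    proof (cases "(v, w) = ({#}, {#})")
      case True
      then show ?thesis using zero_in_gen by simp
    next
      case False
      then have "(v, w) \<in> P0"
        using less.prems unfolding P0_def by simp
      then obtain a b where ab_T: "(a, b) \<in> T'" and le: "\<forall>i\<in>X <+> X'. cnt (a, b) i \<le> cnt (v, w) i"
        using T(3)[of "cnt (v, w)"] T'(3) by auto
      have "count a x \<le> count v x" if "x \<in> X" for x
        using le[rule_format, of "Inl x"] that by (simp add: cnt_def InlI)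
      moreover have "count b x \<le> count w x" if "x \<in> X'" for x
        using le[rule_format, of "Inr x"] that by (simp add: cnt_def InrI)
      ultimately have t: "(a, b) \<in> T'" "\<And>x. x \<in> X \<Longrightarrow> count a x \<le> count v x"
          "\<And>x. x \<in> X' \<Longrightarrow> count b x \<le> count w x"
        using ab_T by auto
      have ab: "set_mset a \<subseteq> X" "set_mset b \<subseteq> X'" "msum.F a = msum.F b" "a \<noteq> {#} \<or> b \<noteq> {#}"
        using t(1) T'(1) unfolding P0_def P_def by auto
      obtain c where c: "v = a + c"
        using count_le_imp_subseteq[OF ab(1)] t(2) by (metis subset_mset.le_iff_add)
      obtain d where d: "w = b + d"
        using count_le_imp_subseteq[OF ab(2)] t(3) by (metis subset_mset.le_iff_add)
      have vw: "set_mset v \<subseteq> X" "set_mset w \<subseteq> X'" "msum.F v = msum.F w" "msum.F v \<notin> Z"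
        using less.prems unfolding P_def by auto
      have "msum.F a \<oplus> msum.F c = msum.F a \<oplus> msum.F d" and nZ: "msum.F a \<oplus> msum.F c \<notin> Z"
        using vw c d ab by auto
      then have "msum.F c = msum.F d"
        by (rule cancel)
      moreover have "msum.F c \<notin> Z"
        using nZ Z_absorbing[of "msum.F c" "msum.F a"] by (metis commute)
      ultimately have "(c, d) \<in> P"
        using vw c d unfolding P_def by auto
      moreover have "size c + size d < size v + size w"
        using ab(4) c d by (auto simp: nonempty_has_size)
      ultimately have "msum.F c \<in> gen Y"
        using less.hyps by blast
      moreover have "msum.F a \<in> gen Y"
      proof (cases "msum.F a = \<zero>")
        case False
        moreover have "msum.F a \<in> (msum.F \<circ> fst) ` T'"
          using t(1) by force
        ultimately show ?thesis
          unfolding Y_def by (intro gen_base) simp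
      qed (simp add: zero_in_gen)
      ultimately show ?thesis
        using c gen_add by simp
    qed
  qed
  moreover have "\<exists>v w. x = msum.F v \<and> (v, w) \<in> P" if "x \<in> gen X \<inter> gen X' - Z" for x
  proof -
    obtain v where "set_mset v \<subseteq> X" "x = msum.F v"
      using \<open>x \<in> gen X \<inter> gen X' - Z\<close> by (auto elim: genE)
    moreover obtain w where "set_mset w \<subseteq> X'" "x = msum.F w"
      using \<open>x \<in> gen X \<inter> gen X' - Z\<close> by (auto elim: genE)
    ultimately show ?thesis
      using that unfolding P_def by (intro exI[of _ v] exI[of _ w]) auto
  qed
  ultimately have "gen X \<inter> gen X' - Z \<subseteq> gen Y"
    by blast
  moreover have Y: "Y \<subseteq> gen X \<inter> gen X'"
  proof -
    have "msum.F v \<in> gen X \<and> msum.F v \<in> gen X'" if "(v, w) \<in> P" for v w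
      using that genI[of v X] genI[of w X'] unfolding P_def by auto
    then show ?thesis
      using T'(1) unfolding Y_def P0_def by auto
  qed
  then have "gen Y \<subseteq> gen X \<inter> gen X'"
    by (intro gen_closed_subset) (use gen_add zero_in_gen in blast)+
  moreover have "finite Y"
    using T'(2) unfolding Y_def by simp
  ultimately show ?thesis
    using Y by (intro exI[of _ Y]) (auto simp: Y_def)
qed

section \<open>Hilbert series and their rationality\<close>

definition hilb :: "'b set \<Rightarrow> int fps" where
  "hilb A = Abs_fps (\<lambda>q. int (card {x \<in> A. deg x = q}))"

text \<open>\<open>card\<close> is 0 on infinite degree pieces, so additivity needs the finiteness
  hypothesis; it will come from generators of positive degree.\<close>

lemma hilb_Diff:
  assumes "\<And>q. finite {x \<in> A. deg x = q}"
  shows "hilb (A - B) = hilb A - hilb (A \<inter> B)"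
proof (rule fps_ext)
  fix q
  have "{x \<in> A. deg x = q} = {x \<in> A - B. deg x = q} \<union> {x \<in> A \<inter> B. deg x = q}"
    by auto
  moreover have "card ({x \<in> A - B. deg x = q} \<union> {x \<in> A \<inter> B. deg x = q}) =
      card {x \<in> A - B. deg x = q} + card {x \<in> A \<inter> B. deg x = q}"
    using assms[of q] by (intro card_Un_disjoint) (auto elim: rev_finite_subset)
  ultimately show "hilb (A - B) $ q = (hilb A - hilb (A \<inter> B)) $ q"
    by (simp add: hilb_def)
qed

lemma hilb_translate:
  assumes "inj_on (\<lambda>s. s \<oplus> x) A"
  shows "hilb ((\<lambda>s. s \<oplus> x) ` A) = fps_X ^ deg x * hilb A"
proof (rule fps_ext)
  fix q
  have *: "{y \<in> (\<lambda>s. s \<oplus> x) ` A. deg y = q} = (\<lambda>s. s \<oplus> x) ` {s \<in> A. deg s + deg x = q}"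
    by (auto simp: deg_add)
  have "card {y \<in> (\<lambda>s. s \<oplus> x) ` A. deg y = q} = card {s \<in> A. deg s + deg x = q}"
    unfolding * by (rule card_image) (use assms in \<open>auto elim: inj_on_subset\<close>)
  also have "{s \<in> A. deg s + deg x = q} = (if q < deg x then {} else {s \<in> A. deg s = q - deg x})"
    by auto
  finally show "hilb ((\<lambda>s. s \<oplus> x) ` A) $ q = (fps_X ^ deg x * hilb A) $ q"
    by (simp add: hilb_def fps_X_power_mult_nth)
qed

lemma rational_hilb_finite:
  assumes "finite A"
  shows "rational_gf (hilb A)"
proof -
  have "coeff (\<Sum>x\<in>A. monom (1::int) (deg x)) q = int (card {x \<in> A. deg x = q})" for q
    using assms sum.inter_filter[of A "\<lambda>_. 1::int" "\<lambda>x. deg x = q"] by (simp add: coeff_sum)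
  then have "hilb A = fps_of_poly (\<Sum>x\<in>A. monom 1 (deg x))"
    by (intro fps_ext) (simp add: hilb_def)
  then show ?thesis
    by (simp add: rational_gf_poly)
qed

text \<open>Hilbert's argument: on \<open>U - V\<close>, adding \<open>x\<close> is injective away from its kernel, and kernel and
  cokernel are again differences of stable sets, on which \<open>x\<close> acts trivially.\<close>

lemma rational_hilb_stable_Diff:
  assumes Y: "finite Y" "\<And>y. y \<in> Y \<Longrightarrow> deg y \<ge> 1"
  assumes "X \<subseteq> Y" and "U \<subseteq> gen Y"
    and "\<And>u y. u \<in> U \<Longrightarrow> y \<in> Y \<Longrightarrow> u \<oplus> y \<in> U"
    and "\<And>v y. v \<in> V \<Longrightarrow> y \<in> Y \<Longrightarrow> v \<oplus> y \<in> V"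
    and "U \<inter> Z \<subseteq> V"
    and "\<And>u y. u \<in> U \<Longrightarrow> y \<in> Y - X \<Longrightarrow> u \<oplus> y \<in> V"
  shows "rational_gf (hilb (U - V))"
proof -
  have "finite X"
    using assms(1,3) by (rule rev_finite_subset)
  then show ?thesis
    using assms(3-)
  \<comment> \<open>\<open>X\<close> holds the generators that may still act nontrivially on
    \<open>U - V\<close>. Taking one out of \<open>X\<close> means passing to two other differences,
    so \<open>U\<close> and \<open>V\<close> vary.\<close>
  proof (induction X arbitrary: U V)
    case empty
    obtain T where T: "T \<subseteq> U" "finite T"
      "\<And>u. u \<in> U \<Longrightarrow> \<exists>t\<in>T. \<exists>w. set_mset w \<subseteq> Y \<and> u = t \<oplus> msum.F w"
      using noetherian[OF Y(1) empty.prems(2)] by blast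
    have absorbed: "t \<oplus> msum.F w \<in> U \<and> (w \<noteq> {#} \<longrightarrow> t \<oplus> msum.F w \<in> V)" if "t \<in> U" "set_mset w \<subseteq> Y" for t w
      using that(2)
    proof (induction w)
      case (add y w)
      have "t \<oplus> msum.F (add_mset y w) = (t \<oplus> msum.F w) \<oplus> y"
        by (simp add: ac_simps)
      then show ?case
        using add empty.prems(3,6) by simp
    qed (use that in simp)
    \<comment> \<open>With \<open>X\<close> empty every generator moves \<open>U\<close> into
      \<open>V\<close>, so whatever lies outside \<open>V\<close> is one of the finitely many
      generators of \<open>U\<close>.\<close>
    have "U - V \<subseteq> T"
    proof
      fix u assume u: "u \<in> U - V"
      then obtain t w where tw: "t \<in> T" "set_mset w \<subseteq> Y" "u = t \<oplus> msum.F w"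
        using T(3) by blast
      then have "w = {#}"
        using absorbed[of t w] T(1) u by blast
      then show "u \<in> T"
        using tw by simp
    qed
    then show ?case
      using T(2) by (intro rational_hilb_finite) (rule finite_subset)
  next
    case (insert x X)
    have x: "x \<in> Y" and dx: "deg x \<ge> 1"
      using insert.prems(1) Y(2) by auto
    note stU = insert.prems(3) and stV = insert.prems(4)
    define K where "K = {s \<in> U. s \<oplus> x \<in> V}"
    define W where "W = V \<union> (\<lambda>s. s \<oplus> x) ` U"
    have swap: "(s \<oplus> y) \<oplus> x = (s \<oplus> x) \<oplus> y" for s y
      by (simp add: ac_simps)
    have ker: "rational_gf (hilb (K - V))"
    proof (rule insert.IH)
      show "K \<subseteq> gen Y" "K \<inter> Z \<subseteq> V" "X \<subseteq> Y"
        using insert.prems unfolding K_def by auto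
      show "u \<oplus> y \<in> K" if "u \<in> K" "y \<in> Y" for u y
        using that stU stV unfolding K_def by (auto simp: swap)
      show "u \<oplus> y \<in> V" if "u \<in> K" "y \<in> Y - X" for u y
        using that insert.prems(6) unfolding K_def by (cases "y = x") auto
    qed (use stV in auto)
    have coker: "rational_gf (hilb (U - W))"
    proof (rule insert.IH)
      show "U \<subseteq> gen Y" "U \<inter> Z \<subseteq> W" "X \<subseteq> Y"
        using insert.prems unfolding W_def by auto
      show "v \<oplus> y \<in> W" if "v \<in> W" "y \<in> Y" for v y
        using that stU stV unfolding W_def by (auto simp flip: swap)
      show "u \<oplus> y \<in> W" if "u \<in> U" "y \<in> Y - X" for u y
        using that insert.prems(6) unfolding W_def by (cases "y = x") auto
    qed (use stU in auto)
    have fin: "finite {s \<in> A. deg s = q}" if "A \<subseteq> U" for A q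
      by (rule finite_subset[OF _ finite_gen_deg[OF Y, of q]]) (use that insert.prems(2) in auto)
    have "hilb (U - V - K) = hilb (U - V) - hilb ((U - V) \<inter> K)"
      by (rule hilb_Diff) (rule fin, auto)
    moreover have "U - V - K = U - K" and "(U - V) \<inter> K = K - V"
      using stV x unfolding K_def by auto
    ultimately have 1: "hilb (U - K) = hilb (U - V) - hilb (K - V)"
      by simp
    have "hilb (U - V - W) = hilb (U - V) - hilb ((U - V) \<inter> W)"
      by (rule hilb_Diff) (rule fin, auto)
    moreover have "U - V - W = U - W" and "(U - V) \<inter> W = (\<lambda>s. s \<oplus> x) ` (U - K)"
      using stU x unfolding K_def W_def by auto
    ultimately have 2: "hilb (U - W) = hilb (U - V) - hilb ((\<lambda>s. s \<oplus> x) ` (U - K))"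
      by simp
    \<comment> \<open>Outside \<open>K\<close> the sum stays in \<open>U\<close> but avoids
      \<open>V\<close>, hence avoids \<open>Z\<close>, so cancellation applies.\<close>
    have "inj_on (\<lambda>s. s \<oplus> x) (U - K)"
    proof (rule inj_onI)
      fix s t assume st: "s \<in> U - K" "t \<in> U - K" "s \<oplus> x = t \<oplus> x"
      then have "s \<oplus> x \<notin> Z"
        using stU x insert.prems(5) unfolding K_def by auto
      then show "s = t"
        using cancel[of x s t] st(3) by (simp add: commute)
    qed
    then have 3: "hilb ((\<lambda>s. s \<oplus> x) ` (U - K)) = fps_X ^ deg x * hilb (U - K)"
      by (rule hilb_translate)
    \<comment> \<open>Alternating sum over kernel, source, target and cokernel of adding
      \<open>x\<close>; kernel and source carry the shift by \<open>deg x\<close>.\<close>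
    have "hilb (U - V) * (1 - fps_X ^ deg x) = hilb (U - W) - fps_X ^ deg x * hilb (K - V)"
      unfolding 2 3 1 by (simp add: algebra_simps)
    then have "rational_gf (hilb (U - V) * (1 - fps_X ^ deg x))"
      using rational_gf_diff[OF coker rational_gf_X_power_mult[OF ker]] by simp
    then show ?case
      using dx by (rule rational_gf_cancel)
  qed
qed

lemma rational_hilb_gen:
  assumes "finite Y" "\<And>y. y \<in> Y \<Longrightarrow> deg y \<ge> 1"
  shows "rational_gf (hilb (gen Y - Z))"
proof -
  have "rational_gf (hilb (gen Y - gen Y \<inter> Z))"
    by (rule rational_hilb_stable_Diff[OF assms, of Y]) (auto intro: gen_add gen_base Z_absorbing)
  moreover have "gen Y - gen Y \<inter> Z = gen Y - Z"
    by auto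
  ultimately show ?thesis by simp
qed

lemma deg_gen_nonzero:
  assumes "\<And>y. y \<in> Y \<Longrightarrow> deg y \<ge> 1" and "x \<in> gen Y" and "x \<noteq> \<zero>"
  shows "deg x \<ge> 1"
proof -
  obtain w where w: "set_mset w \<subseteq> Y" "x = msum.F w"
    using assms(2) by (rule genE)
  then obtain y v where "w = add_mset y v"
    using assms(3) by (cases w) auto
  then show ?thesis
    using w assms(1)[of y] by (simp add: deg_add)
qed

text \<open>Inclusion-exclusion one submonoid at a time: the part cut off by
  \<open>gen (X g)\<close> has the same shape, with \<open>Y\<close> replaced by generators
  \<open>Y'\<close> of the intersection. The sets \<open>X f\<close> may contain elements of degree
  0; \<open>Y'\<close> inherits positive degrees because it consists of nonzero elements of
  \<open>gen Y\<close>.\<close>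

lemma rational_hilb_gen_Diff_UN:
  assumes "finite F" and X: "\<And>f. f \<in> F \<Longrightarrow> finite (X f)"
    and "finite Y" and "\<And>y. y \<in> Y \<Longrightarrow> deg y \<ge> 1"
  shows "rational_gf (hilb (gen Y - Z - (\<Union>f\<in>F. gen (X f))))"
  using assms
proof (induction F arbitrary: Y)
  case empty
  then show ?case using rational_hilb_gen by simp
next
  case (insert g F)
  obtain Y' where Y': "finite Y'" "gen Y' - Z = gen Y \<inter> gen (X g) - Z" "Y' \<subseteq> gen Y \<inter> gen (X g) - {\<zero>}"
    using finitely_generated_Int[of Y "X g"] insert.prems by auto
  define A where "A = gen Y - Z - (\<Union>f\<in>F. gen (X f))"
  have "rational_gf (hilb A)"
    unfolding A_def using insert by auto
  moreover have "rational_gf (hilb (gen Y' - Z - (\<Union>f\<in>F. gen (X f))))"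
    using deg_gen_nonzero[OF insert.prems(3)] Y' insert by (intro insert.IH) auto
  moreover have "gen Y' - Z - (\<Union>f\<in>F. gen (X f)) = A \<inter> gen (X g)"
    unfolding Y'(2) A_def by auto
  moreover have "hilb (A - gen (X g)) = hilb A - hilb (A \<inter> gen (X g))"
  proof (rule hilb_Diff)
    show "finite {x \<in> A. deg x = q}" for q
      by (rule finite_subset[OF _ finite_gen_deg[OF insert.prems(2,3), of q]]) (auto simp: A_def)
  qed
  moreover have "gen Y - Z - (\<Union>f\<in>insert g F. gen (X f)) = A - gen (X g)"
    unfolding A_def by auto
  ultimately show ?case
    using rational_gf_diff by simp
qed

end

section \<open>The Hilbert--Kunz function of a cancellative binoid\<close>

text \<open>A total addition on the whole type, so that library locales apply: junk elements outside
  the carrier are fixed by units and sent to infinity by everything else, which keeps associativity.\<close>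

definition total_plus :: "'a binoid \<Rightarrow> 'a \<Rightarrow> 'a \<Rightarrow> 'a" where
  "total_plus N a b =
     (if a \<in> bcarrier N \<and> b \<in> bcarrier N then bplus N a b
      else if a \<in> bunits N then b else if b \<in> bunits N then a else binf N)"

no_notation infinity (\<open>\<infinity>\<close>)

locale hk_binoid =
  fixes N :: "'a binoid" and n :: "'a set"
  assumes binoid: "is_binoid N" and fg: "fin_gen N" and semipos: "semipositive N"
    and cancellative: "cancellative N" and primary: "primary_ideal N n"
begin

abbreviation C where "C \<equiv> bcarrier N"
abbreviation plus (infixl "\<oplus>" 65) where "a \<oplus> b \<equiv> bplus N a b"
abbreviation mul (infixr "\<cdot>" 70) where "k \<cdot> a \<equiv> bmult N k a"
abbreviation zer ("\<zero>") where "\<zero> \<equiv> bzero N"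
abbreviation inf_elt ("\<infinity>") where "\<infinity> \<equiv> binf N"
abbreviation units where "units \<equiv> bunits N"

lemma plus_closed [simp]: "a \<in> C \<Longrightarrow> b \<in> C \<Longrightarrow> a \<oplus> b \<in> C"
  and plus_assoc: "a \<in> C \<Longrightarrow> b \<in> C \<Longrightarrow> c \<in> C \<Longrightarrow> (a \<oplus> b) \<oplus> c = a \<oplus> (b \<oplus> c)"
  and plus_comm: "a \<in> C \<Longrightarrow> b \<in> C \<Longrightarrow> a \<oplus> b = b \<oplus> a"
  and zero_closed [simp]: "\<zero> \<in> C"
  and zero_plus [simp]: "a \<in> C \<Longrightarrow> \<zero> \<oplus> a = a"
  and inf_closed [simp]: "\<infinity> \<in> C"
  and plus_inf [simp]: "a \<in> C \<Longrightarrow> a \<oplus> \<infinity> = \<infinity>"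
  using binoid unfolding is_binoid_def by blast+

lemma plus_zero [simp]: "a \<in> C \<Longrightarrow> a \<oplus> \<zero> = a"
  and inf_plus [simp]: "a \<in> C \<Longrightarrow> \<infinity> \<oplus> a = \<infinity>"
  using plus_comm[of a \<zero>] plus_comm[of \<infinity> a] by simp_all

lemma plus_left_comm: "a \<in> C \<Longrightarrow> b \<in> C \<Longrightarrow> c \<in> C \<Longrightarrow> a \<oplus> (b \<oplus> c) = b \<oplus> (a \<oplus> c)"
  using plus_assoc[of a b c] plus_assoc[of b a c] plus_comm[of a b] by simp

lemmas plus_ac = plus_assoc plus_comm plus_left_comm

lemma zero_neq_inf [simp]: "\<zero> \<noteq> \<infinity>"
proof
  assume "\<zero> = \<infinity>"
  then have "a = \<infinity>" if "a \<in> C" for a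
    using zero_plus[OF that] inf_plus[OF that] by metis
  then have "C = {\<infinity>}"
    using inf_closed by blast
  then show False
    using semipos unfolding semipositive_def by blast
qed

lemmas inf_neq_zero [simp] = zero_neq_inf [symmetric]

lemma units_closed: "u \<in> units \<Longrightarrow> u \<in> C"
  unfolding bunits_def by simp

lemma finite_units: "finite units"
  using semipos unfolding semipositive_def by simp

lemma zero_unit [simp]: "\<zero> \<in> units"
  unfolding bunits_def by (auto intro!: bexI[of _ \<zero>])

lemma inf_not_unit [simp]: "\<infinity> \<notin> units"
  unfolding bunits_def by auto

lemma plus_unit_iff: 
  assumes "a \<in> C" "b \<in> C"
  shows "a \<oplus> b \<in> units \<longleftrightarrow> a \<in> units \<and> b \<in> units"
proof
  assume "a \<oplus> b \<in> units"
  then obtain c where c: "c \<in> C" "(a \<oplus> b) \<oplus> c = \<zero>"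
    unfolding bunits_def by blast
  then have "a \<oplus> (b \<oplus> c) = \<zero>" "b \<oplus> (a \<oplus> c) = \<zero>"
    using assms by (simp_all add: plus_assoc plus_left_comm)
  then show "a \<in> units \<and> b \<in> units"
    using assms c(1) plus_closed unfolding bunits_def by blast
next
  assume "a \<in> units \<and> b \<in> units"
  then obtain a' b' where ab: "a' \<in> C" "a \<oplus> a' = \<zero>" "b' \<in> C" "b \<oplus> b' = \<zero>"
    unfolding bunits_def by blast
  have "(a \<oplus> b) \<oplus> (a' \<oplus> b') = (a \<oplus> a') \<oplus> (b \<oplus> b')"
    using assms ab(1,3) by (simp add: plus_ac)
  then have "(a \<oplus> b) \<oplus> (a' \<oplus> b') = \<zero>"
    using ab by simp
  then show "a \<oplus> b \<in> units"
    using assms ab unfolding bunits_def by (auto intro: bexI[of _ "a' \<oplus> b'"])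
qed

lemma total_plus_eq [simp]: "a \<in> C \<Longrightarrow> b \<in> C \<Longrightarrow> total_plus N a b = a \<oplus> b"
  unfolding total_plus_def by simp

lemma comm_monoid_total_plus: "comm_monoid (total_plus N) \<zero>"
proof
  have CU: "a \<in> units \<Longrightarrow> a \<in> C" for a
    by (rule units_closed)
  show "total_plus N (total_plus N a b) c = total_plus N a (total_plus N b c)" for a b c
    using CU[of a] CU[of b] CU[of c]
    by (cases "a \<in> C"; cases "b \<in> C"; cases "c \<in> C"; cases "a \<in> units"; cases "b \<in> units"; cases "c \<in> units")
      (simp_all add: total_plus_def plus_unit_iff plus_assoc)
  show "total_plus N a b = total_plus N b a" for a b
    using CU[of a] CU[of b] by (auto simp: total_plus_def plus_comm)
  show "total_plus N a \<zero> = a" for a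
    using CU[of a] by (auto simp: total_plus_def)
qed

text \<open>The locale axioms quantify over the whole type, so junk outside the carrier is treated
  like infinity.\<close>

definition Z where "Z = - (C - {\<infinity>})"

lemma Z_total_plus:
  assumes "x \<in> Z"
  shows "total_plus N x y \<in> Z"
  using assms units_closed[of y] units_closed[of x]
  by (cases "x \<in> C"; cases "y \<in> C"; cases "y \<in> units") (auto simp: Z_def total_plus_def)

lemma cancel_total_plus:
  assumes "total_plus N x y = total_plus N x w" "total_plus N x y \<notin> Z"
  shows "y = w"
proof -
  interpret comm_monoid "total_plus N" \<zero>
    by (rule comm_monoid_total_plus)
  have "x \<notin> Z"
    using Z_total_plus[of x y] assms(2) by blast
  moreover have "y \<notin> Z"
    using Z_total_plus[of y x] assms(2) unfolding commute[of x y] by blast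
  moreover have "w \<notin> Z"
    using Z_total_plus[of w x] assms(2) unfolding assms(1) commute[of x w] by blast
  ultimately have xyw: "x \<in> C" "y \<in> C" "w \<in> C"
    unfolding Z_def by blast+
  then have "x \<oplus> y = x \<oplus> w" "x \<oplus> y \<noteq> \<infinity>"
    using assms by (simp_all add: Z_def)
  then show ?thesis
    using cancellative xyw unfolding cancellative_def by blast
qed

sublocale T: graded_monoid "total_plus N" \<zero> Z "\<lambda>_. 0"
  by (intro graded_monoid.intro graded_monoid_axioms.intro comm_monoid_total_plus)
    (fact Z_total_plus cancel_total_plus | simp)+

definition pair_plus :: "nat \<times> 'a \<Rightarrow> nat \<times> 'a \<Rightarrow> nat \<times> 'a" where
  "pair_plus p r = (fst p + fst r, total_plus N (snd p) (snd r))"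

lemma pair_plus_simp [simp]: "pair_plus (i, a) (j, b) = (i + j, total_plus N a b)"
  unfolding pair_plus_def by simp

lemma comm_monoid_pair_plus: "comm_monoid pair_plus (0, \<zero>)"
proof
  show "pair_plus (pair_plus x y) z = pair_plus x (pair_plus y z)" for x y z
    unfolding pair_plus_def fst_conv snd_conv T.assoc add.assoc ..
  show "pair_plus x y = pair_plus y x" for x y
    unfolding pair_plus_def T.commute[of "snd x"] add.commute[of "fst x"] ..
  show "pair_plus x (0, \<zero>) = x" for x
    unfolding pair_plus_def fst_conv snd_conv T.right_neutral add_0_right prod.collapse ..
qed

lemma cancel_pair_plus:
  assumes "pair_plus x y = pair_plus x w" "pair_plus x y \<notin> UNIV \<times> Z"
  shows "y = w"
proof (rule prod_eqI)
  show "fst y = fst w"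
    using assms(1) by (simp add: pair_plus_def)
  show "snd y = snd w"
    by (rule cancel_total_plus[of "snd x"]) (use assms in \<open>simp_all add: pair_plus_def\<close>)
qed

lemma Z_pair_plus: "x \<in> UNIV \<times> Z \<Longrightarrow> pair_plus x y \<in> UNIV \<times> Z"
  using Z_total_plus[of "snd x" "snd y"] by (cases x) (simp add: pair_plus_def)

sublocale P: graded_monoid pair_plus "(0, \<zero>)" "UNIV \<times> Z" fst
  by (intro graded_monoid.intro graded_monoid_axioms.intro comm_monoid_pair_plus)
    (fact Z_pair_plus cancel_pair_plus | simp add: pair_plus_def)+

lemma mul_0 [simp]: "0 \<cdot> a = \<zero>"
  and mul_Suc: "Suc k \<cdot> a = a \<oplus> (k \<cdot> a)"
  unfolding bmult_def by simp_all

lemma mul_closed [simp]: "a \<in> C \<Longrightarrow> k \<cdot> a \<in> C"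
  by (induction k) (simp_all add: mul_Suc)

lemma mul_add: "a \<in> C \<Longrightarrow> (j + k) \<cdot> a = (j \<cdot> a) \<oplus> (k \<cdot> a)"
  by (induction j) (simp_all add: mul_Suc plus_assoc)

lemma mul_plus: "a \<in> C \<Longrightarrow> b \<in> C \<Longrightarrow> k \<cdot> (a \<oplus> b) = (k \<cdot> a) \<oplus> (k \<cdot> b)"
  by (induction k) (simp_all add: mul_Suc plus_ac)

lemma mul_mul: "a \<in> C \<Longrightarrow> j \<cdot> (k \<cdot> a) = (j * k) \<cdot> a"
  by (induction j) (simp_all add: mul_Suc mul_add)

lemma msum_replicate: "a \<in> C \<Longrightarrow> T.msum.F (replicate_mset k a) = k \<cdot> a"
  by (induction k) (simp_all add: mul_Suc)

lemma msum_closed: "set_mset w \<subseteq> C \<Longrightarrow> T.msum.F w \<in> C"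
  by (induction w) simp_all

text \<open>Units are added to a chosen finite generating set so that any sum of units, however
  long, is itself one generator.\<close>

definition G where "G = (SOME G. finite G \<and> G \<subseteq> C \<and> bgen N G = C) \<union> units"

lemma G: "finite G" "G \<subseteq> C" "units \<subseteq> G" and gen_G: "T.gen G = C"
proof -
  define H where "H = (SOME G. finite G \<and> G \<subseteq> C \<and> bgen N G = C)"
  have H: "finite H" "H \<subseteq> C" "bgen N H = C"
    unfolding H_def by (rule someI_ex[OF fg[unfolded fin_gen_def], THEN conjunct1]
      someI_ex[OF fg[unfolded fin_gen_def], THEN conjunct2, THEN conjunct1]
      someI_ex[OF fg[unfolded fin_gen_def], THEN conjunct2, THEN conjunct2])+
  show fin: "finite G" and GC: "G \<subseteq> C" and "units \<subseteq> G"
    using H finite_units units_closed unfolding G_def H_def[symmetric] by auto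
  show "T.gen G = C"
  proof
    show "T.gen G \<subseteq> C"
      by (rule T.gen_closed_subset) (use GC in auto)
    have "x \<in> C \<and> x \<in> T.gen G" if "x \<in> bgen N H" for x
      using that
    proof induction
      case zero
      show ?case using T.zero_in_gen by simp
    next
      case (gen g)
      then show ?case
        using H(2) by (auto intro!: T.gen_base simp: G_def H_def[symmetric])
    next
      case (plus a b)
      then show ?case
        using T.gen_add[of a G b] by simp
    qed
    then show "C \<subseteq> T.gen G"
      using H(3) by blast
  qed
qed

lemma ideal_fg:
  assumes "bideal N I"
  shows "\<exists>T\<subseteq>I. finite T \<and> (\<forall>u\<in>I. \<exists>t\<in>T. \<exists>c\<in>C. u = t \<oplus> c)"
proof -
  have IC: "I \<subseteq> C"
    using assms unfolding bideal_def by blast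
  then have "I \<subseteq> T.gen G"
    using gen_G by simp
  from T.noetherian[OF G(1) this] obtain T where T: "T \<subseteq> I" "finite T"
    "\<forall>u\<in>I. \<exists>t\<in>T. \<exists>w. set_mset w \<subseteq> G \<and> u = total_plus N t (T.msum.F w)"
    by (elim exE conjE)
  have "\<exists>t\<in>T. \<exists>c\<in>C. u = t \<oplus> c" if "u \<in> I" for u
  proof -
    from T(3)[rule_format, OF that]
    obtain t w where t: "t \<in> T" and w: "set_mset w \<subseteq> G" "u = total_plus N t (T.msum.F w)"
      by (elim bexE exE conjE)
    have F: "T.msum.F w \<in> C"
      by (rule msum_closed[OF subset_trans[OF w(1) G(2)]])
    have "t \<in> C"
      by (rule subsetD[OF subset_trans[OF T(1) IC] t])
    then have "u = t \<oplus> T.msum.F w"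
      unfolding w(2) using F by (rule total_plus_eq)
    then show ?thesis
      by (intro bexI[OF _ t] bexI[OF _ F])
  qed
  then show ?thesis
    using T(1,2) by (intro exI[of _ T]) simp
qed

section \<open>Frobenius ideals as fibres of graded submonoids\<close>

lemma n_ideal: "bideal N n" and n_nonunits: "n \<subseteq> bpos_part N"
  and n_primary: "a \<in> bpos_part N \<Longrightarrow> \<exists>k\<ge>1. k \<cdot> a \<in> n"
  using primary unfolding primary_ideal_def by blast+

lemma n_closed: "f \<in> n \<Longrightarrow> f \<in> C"
  using n_ideal unfolding bideal_def by blast

definition frob :: "nat \<Rightarrow> 'a set" where
  "frob q = {(q \<cdot> f) \<oplus> c | f c. f \<in> n \<and> c \<in> C}"

lemma frobI: "f \<in> n \<Longrightarrow> c \<in> C \<Longrightarrow> (q \<cdot> f) \<oplus> c \<in> frob q"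
  unfolding frob_def by blast

lemma frob_plus:
  assumes "x \<in> frob q" "y \<in> C"
  shows "x \<oplus> y \<in> frob q"
proof -
  obtain f c where fc: "f \<in> n" "c \<in> C" "x = (q \<cdot> f) \<oplus> c"
    using assms(1) unfolding frob_def by blast
  then have "x \<oplus> y = (q \<cdot> f) \<oplus> (c \<oplus> y)"
    using assms(2) n_closed by (simp add: plus_assoc)
  then show ?thesis
    using frobI[of f "c \<oplus> y"] fc assms(2) by simp
qed

lemma HKF_eq: "HKF N n q = card (C - frob q)"
proof -
  have "frob_ideal N q n = frob q"
    unfolding frob_ideal_def bsum_def frob_def by blast
  moreover have "bsum N (frob q) C = frob q"
  proof
    show "bsum N (frob q) C \<subseteq> frob q"
      unfolding bsum_def using frob_plus by blast
    have "\<exists>c\<in>C. x = x \<oplus> c" if "x \<in> frob q" for x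
      using that n_closed unfolding frob_def by (auto intro!: bexI[of _ \<zero>])
    then show "frob q \<subseteq> bsum N (frob q) C"
      unfolding bsum_def by blast
  qed
  ultimately show ?thesis
    unfolding HKF_def by simp
qed

lemma frob_antimono: "frob (Suc q) \<subseteq> frob q"
proof
  fix x assume "x \<in> frob (Suc q)"
  then obtain f c where fc: "f \<in> n" "c \<in> C" "x = (Suc q \<cdot> f) \<oplus> c"
    unfolding frob_def by blast
  then have "x = (q \<cdot> f) \<oplus> (f \<oplus> c)"
    using n_closed by (simp add: mul_Suc plus_ac)
  then show "x \<in> frob q"
    using frobI[of f "f \<oplus> c"] fc n_closed by simp
qed

lemma inf_in_frob: "\<infinity> \<in> frob q"
proof -
  obtain f where "f \<in> n"
    using n_ideal unfolding bideal_def by blast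
  then show ?thesis
    using frobI[of f \<infinity> q] n_closed by simp
qed

text \<open>Pairs \<open>(q, qf + c)\<close> are closed under addition only while \<open>f\<close>
  is fixed, hence one submonoid for each generator of the ideal. The copy of \<open>G\<close> in
  degree 0 produces the summand \<open>c\<close>.\<close>

definition translate_gens :: "'a \<Rightarrow> (nat \<times> 'a) set" where
  "translate_gens f = insert (1, f) ({0} \<times> G)"

lemma gen_translate_gens:
  assumes f: "f \<in> C"
  shows "P.gen (translate_gens f) = {(q, (q \<cdot> f) \<oplus> c) | q c. c \<in> C}" (is "_ = ?R")
proof
  show "P.gen (translate_gens f) \<subseteq> ?R"
  proof (rule P.gen_closed_subset)
    show "(0, \<zero>) \<in> ?R"
      by (auto intro!: exI[of _ \<zero>])
    fix x y assume "x \<in> ?R" and y: "y \<in> translate_gens f"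
    then obtain q c where x: "x = (q, (q \<cdot> f) \<oplus> c)" and c: "c \<in> C"
      by blast
    consider "y = (1, f)" | g where "g \<in> G" "y = (0, g)"
      using y unfolding translate_gens_def by auto
    then show "pair_plus x y \<in> ?R"
    proof cases
      case 1
      then have "pair_plus x y = (Suc q, (Suc q \<cdot> f) \<oplus> c)"
        using x c f by (simp add: mul_Suc plus_ac)
      then show ?thesis using c by blast
    next
      case 2
      then have g: "g \<in> C"
        using G(2) by blast
      then have "pair_plus x y = (q, (q \<cdot> f) \<oplus> (c \<oplus> g))"
        using x c f 2 by (simp add: plus_assoc)
      then show ?thesis
        using c g plus_closed by blast
    qed
  qed
  have "(q, q \<cdot> f) \<in> P.gen (translate_gens f)" for q
  proof (induction q)
    case 0
    show ?case using P.zero_in_gen by simp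
  next
    case (Suc q)
    have "(1, f) \<in> P.gen (translate_gens f)"
      by (rule P.gen_base) (simp add: translate_gens_def)
    then show ?case
      using P.gen_add[of "(1, f)" _ "(q, q \<cdot> f)"] Suc f by (simp add: mul_Suc)
  qed
  moreover have "T.gen G \<subseteq> {c. c \<in> C \<and> (0, c) \<in> P.gen (translate_gens f)}"
  proof (rule T.gen_closed_subset)
    show "\<zero> \<in> {c. c \<in> C \<and> (0, c) \<in> P.gen (translate_gens f)}"
      using P.zero_in_gen by simp
    fix x g assume x: "x \<in> {c. c \<in> C \<and> (0, c) \<in> P.gen (translate_gens f)}" and g: "g \<in> G"
    have "(0, g) \<in> P.gen (translate_gens f)"
      by (rule P.gen_base) (simp add: translate_gens_def g)
    then show "total_plus N x g \<in> {c. c \<in> C \<and> (0, c) \<in> P.gen (translate_gens f)}"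
      using P.gen_add[of "(0, x)" "translate_gens f" "(0, g)"] x g G(2) by auto
  qed
  ultimately have "(q, (q \<cdot> f) \<oplus> c) \<in> P.gen (translate_gens f)" if "c \<in> C" for q c
    using P.gen_add[of "(q, q \<cdot> f)" "translate_gens f" "(0, c)"] that f gen_G by auto
  then show "?R \<subseteq> P.gen (translate_gens f)"
    by blast
qed

definition short_sums :: "nat \<Rightarrow> 'a set" where
  "short_sums K = T.msum.F ` {w. set_mset w \<subseteq> G \<and> size w \<le> K}"

lemma finite_short_sums: "finite (short_sums K)"
proof -
  have "{w. set_mset w \<subseteq> G \<and> size w \<le> K} = (\<Union>k\<le>K. multisets_of_size G k)"
    by (auto simp: multisets_of_size_def)
  then show ?thesis
    using G(1) unfolding short_sums_def by auto
qed

text \<open>An expression is cut into \<open>q\<close> blocks of at most \<open>K\<close> summands,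
  possibly empty, and each block is one generator in degree 1.\<close>

lemma gen_short_sums:
  assumes "set_mset w \<subseteq> G" and "size w \<le> q * K"
  shows "(q, T.msum.F w) \<in> P.gen ({1} \<times> short_sums K)"
  using assms
proof (induction q arbitrary: w)
  case 0
  then show ?case using P.zero_in_gen by simp
next
  case (Suc q)
  obtain xs where xs: "mset xs = w"
    using ex_mset by blast
  define u v where "u = mset (take K xs)" and "v = mset (drop K xs)"
  have w: "w = u + v"
    unfolding u_def v_def using xs by (metis append_take_drop_id mset_append)
  have "size w = length xs"
    using xs by auto
  then have "size u \<le> K" "size v \<le> q * K"
    using Suc.prems(2) unfolding u_def v_def by auto
  then have "(q, T.msum.F v) \<in> P.gen ({1} \<times> short_sums K)"
    using Suc w by simp
  moreover have "(1, T.msum.F u) \<in> P.gen ({1} \<times> short_sums K)"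
    using \<open>size u \<le> K\<close> Suc.prems(1) w by (intro P.gen_base) (auto simp: short_sums_def)
  ultimately show ?case
    using P.gen_add[of "(1, T.msum.F u)" _ "(q, T.msum.F v)"] w by simp
qed

text \<open>If \<open>k g\<close> copies of a nonunit generator \<open>g\<close> sum into the ideal
  and \<open>g\<close> occurs more than \<open>q * k g\<close> times, the sum contains
  \<open>q\<close> times an element of the ideal and lies in \<open>frob q\<close>. All units in an
  expression collapse to one generator.\<close>

lemma outside_frob_short:
  "\<exists>K. \<forall>q\<ge>1. \<forall>a\<in>C - frob q. \<exists>w. set_mset w \<subseteq> G \<and> size w \<le> q * K \<and> a = T.msum.F w"
proof -
  have "\<forall>g\<in>G - units. \<exists>k\<ge>1. k \<cdot> g \<in> n"
    using n_primary G(2) unfolding bpos_part_def by blast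
  then obtain k where k: "\<And>g. g \<in> G - units \<Longrightarrow> k g \<cdot> g \<in> n"
    by metis
  \<comment> \<open>The successor accounts for the single generator that replaces all units;
    \<open>q \<ge> 1\<close> makes it fit into \<open>q * K\<close>.\<close>
  define K where "K = Suc (\<Sum>g\<in>G - units. k g)"
  have "\<exists>w. set_mset w \<subseteq> G \<and> size w \<le> q * K \<and> a = T.msum.F w" if q: "q \<ge> 1" and a: "a \<in> C - frob q" for q a
  proof -
    have "a \<in> T.gen G"
      using a gen_G by simp
    then obtain w where w: "set_mset w \<subseteq> G" "a = T.msum.F w"
      by (rule T.genE)
    define u v where "u = filter_mset (\<lambda>g. g \<in> units) w" and "v = filter_mset (\<lambda>g. g \<notin> units) w"
    have w_uv: "w = u + v"
      unfolding u_def v_def by (rule multiset_partition)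
    have vG: "set_mset v \<subseteq> G - units"
      using w(1) unfolding v_def by auto
    have vC: "set_mset v \<subseteq> C"
      using vG G(2) by blast
    have "set_mset u \<subseteq> units"
      unfolding u_def by auto
    then have "T.msum.F u \<in> units \<and> T.msum.F u \<in> C"
    proof (induction u)
      case (add g u)
      then show ?case
        using units_closed[of g] by (simp add: plus_unit_iff)
    qed simp
    then have u: "T.msum.F u \<in> units" "T.msum.F u \<in> C"
      by auto
    have a_eq: "a = T.msum.F u \<oplus> T.msum.F v"
      using w(2) w_uv u msum_closed[OF vC] by simp
    have count: "count v g \<le> q * k g" if "g \<in> G - units" for g
    proof (rule ccontr)
      assume "\<not> count v g \<le> q * k g"
      then have "replicate_mset (q * k g) g \<subseteq># v"
        by (simp flip: count_le_replicate_mset_subset_eq)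
      then obtain v' where v': "v = replicate_mset (q * k g) g + v'"
        by (metis subset_mset.le_iff_add)
      have g: "g \<in> C"
        using that G(2) by blast
      have F': "T.msum.F v' \<in> C"
        using vC v' by (intro msum_closed) auto
      have "T.msum.F v = (q \<cdot> k g \<cdot> g) \<oplus> T.msum.F v'"
        using g F' unfolding v' by (simp add: msum_replicate mul_mul)
      then have "a = (q \<cdot> k g \<cdot> g) \<oplus> (T.msum.F v' \<oplus> T.msum.F u)"
        using a_eq g F' u(2) by (simp add: plus_ac)
      then show False
        using frobI[OF k[OF that], of "T.msum.F v' \<oplus> T.msum.F u" q] F' u(2) a by simp
    qed
    have "size v = (\<Sum>g\<in>set_mset v. count v g)"
      by (rule size_multiset_overloaded_eq)
    also have "\<dots> \<le> (\<Sum>g\<in>G - units. count v g)"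
      using G(1) vG by (intro sum_mono2) auto
    also have "\<dots> \<le> (\<Sum>g\<in>G - units. q * k g)"
      by (intro sum_mono count)
    also have "\<dots> = q * (\<Sum>g\<in>G - units. k g)"
      by (simp add: sum_distrib_left)
    finally have "size (add_mset (T.msum.F u) v) \<le> q * K"
      using q unfolding K_def by simp
    moreover have "a = T.msum.F (add_mset (T.msum.F u) v)"
      using a_eq u msum_closed[OF vC] by simp
    moreover have "set_mset (add_mset (T.msum.F u) v) \<subseteq> G"
      using vG u G(3) by auto
    ultimately show ?thesis by blast
  qed
  then show ?thesis by blast
qed

text \<open>\<open>h\<close> counts the degree pieces of a graded set whose fibres are the
  complements of \<open>frob q\<close> for \<open>q \<ge> 1\<close>, the range in which
  \<open>K\<close> is available. As this set lies in a monoid generated by finitely many elements of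
  degree 1, the complements also turn out to be finite.\<close>

lemma rational_HKF:
  "\<exists>h. rational_gf (Abs_fps (\<lambda>q. int (h q))) \<and> (\<forall>q\<ge>1. h q = HKF N n q \<and> finite (C - frob q))"
proof -
  from outside_frob_short obtain K where
    K: "\<forall>q\<ge>1. \<forall>a\<in>C - frob q. \<exists>w. set_mset w \<subseteq> G \<and> size w \<le> q * K \<and> a = T.msum.F w"
    by (rule exE)
  from ideal_fg[OF n_ideal] obtain T where
    T: "T \<subseteq> n" "finite T" "\<forall>u\<in>n. \<exists>t\<in>T. \<exists>c\<in>C. u = t \<oplus> c"
    by (elim exE conjE)
  have TC: "T \<subseteq> C"
    using T(1) n_closed by blast
  \<comment> \<open>Finitely many generators \<open>t\<close> suffice, since
    \<open>q(t + c') + c = qt + (qc' + c)\<close>.\<close>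
  have frob_T: "x \<in> frob q \<longleftrightarrow> (\<exists>t\<in>T. (q, x) \<in> P.gen (translate_gens t))" for q x
  proof
    assume "x \<in> frob q"
    then obtain f c where fc: "f \<in> n" "c \<in> C" "x = (q \<cdot> f) \<oplus> c"
      unfolding frob_def by blast
    from T(3)[rule_format, OF fc(1)] obtain t c' where t: "t \<in> T" "c' \<in> C" "f = t \<oplus> c'"
      by (elim bexE)
    then have "t \<in> C"
      using TC by blast
    then have "x = (q \<cdot> t) \<oplus> ((q \<cdot> c') \<oplus> c)"
      using fc t by (simp add: mul_plus plus_assoc)
    then show "\<exists>t\<in>T. (q, x) \<in> P.gen (translate_gens t)"
      using t(1,2) fc(2) \<open>t \<in> C\<close> by (intro bexI[of _ t]) (auto simp: gen_translate_gens)
  next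
    assume "\<exists>t\<in>T. (q, x) \<in> P.gen (translate_gens t)"
    then obtain t where t: "t \<in> T" "(q, x) \<in> P.gen (translate_gens t)"
      by blast
    then have "t \<in> C"
      using TC by blast
    then show "x \<in> frob q"
      using t T(1) frobI by (auto simp: gen_translate_gens)
  qed
  define Y where "Y = {1::nat} \<times> short_sums K"
  have Y: "finite Y" "\<And>y. y \<in> Y \<Longrightarrow> fst y \<ge> 1"
    using finite_short_sums unfolding Y_def by auto
  define A where "A = P.gen Y - UNIV \<times> Z - (\<Union>t\<in>T. P.gen (translate_gens t))"
  have A_fib: "{p \<in> A. fst p = q} = Pair q ` (C - frob q)" if q: "q \<ge> 1" for q
  proof (intro equalityI subsetI)
    fix p assume "p \<in> {p \<in> A. fst p = q}"
    then obtain x where "p = (q, x)" "p \<in> A"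
      by (cases p) auto
    then show "p \<in> Pair q ` (C - frob q)"
      unfolding A_def Z_def using frob_T by auto
  next
    fix p assume "p \<in> Pair q ` (C - frob q)"
    then obtain x where x: "x \<in> C - frob q" "p = (q, x)"
      by blast
    then have "x \<noteq> \<infinity>"
      using inf_in_frob by blast
    moreover have "(q, x) \<in> P.gen Y"
    proof -
      from K[rule_format, OF q x(1)] obtain w where "set_mset w \<subseteq> G" "size w \<le> q * K" "x = T.msum.F w"
        by (elim exE conjE)
      then show ?thesis
        using gen_short_sums unfolding Y_def by simp
    qed
    ultimately show "p \<in> {p \<in> A. fst p = q}"
      using x frob_T unfolding A_def Z_def by auto
  qed
  have "rational_gf (P.hilb A)"
    unfolding A_def using T(2) Y
    by (intro P.rational_hilb_gen_Diff_UN) (auto simp: translate_gens_def G(1))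
  moreover have "card {p \<in> A. fst p = q} = HKF N n q" "finite (C - frob q)" if "q \<ge> 1" for q
  proof -
    show "card {p \<in> A. fst p = q} = HKF N n q"
      unfolding A_fib[OF that] HKF_eq by (intro card_image inj_onI) simp
    have "finite (Pair q ` (C - frob q))"
      unfolding A_fib[OF that, symmetric]
      by (rule finite_subset[OF _ P.finite_gen_deg[OF Y, of q]]) (auto simp: A_def)
    then show "finite (C - frob q)"
      by (rule finite_imageD) (simp add: inj_on_def)
  qed
  ultimately show ?thesis
    unfolding P.hilb_def by (intro exI[of _ "\<lambda>q. card {p \<in> A. fst p = q}"]) simp
qed

end

section \<open>The growth of the Hilbert--Kunz function\<close>

context hk_binoid
begin

lemma idealI:
  assumes "I \<noteq> {}" "I \<subseteq> C" "\<And>a c. a \<in> I \<Longrightarrow> c \<in> C \<Longrightarrow> a \<oplus> c \<in> I"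
  shows "bideal N I"
  using assms unfolding bideal_def by simp

lemma ideal_closed: "bideal N I \<Longrightarrow> a \<in> I \<Longrightarrow> a \<in> C"
  and ideal_plus: "bideal N I \<Longrightarrow> a \<in> I \<Longrightarrow> c \<in> C \<Longrightarrow> a \<oplus> c \<in> I"
  unfolding bideal_def by auto

lemma ideal_plus': "bideal N I \<Longrightarrow> a \<in> I \<Longrightarrow> c \<in> C \<Longrightarrow> c \<oplus> a \<in> I"
  using ideal_plus[of I a c] ideal_closed[of I a] by (simp add: plus_comm)

lemma ideal_inf:
  assumes "bideal N I"
  shows "\<infinity> \<in> I"
proof -
  obtain a where "a \<in> I"
    using assms unfolding bideal_def by blast
  then show ?thesis
    using ideal_plus[OF assms _ inf_closed] ideal_closed[OF assms] by force
qed

lemma proper_ideal_nonunits: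
  assumes I: "bideal N I" "I \<noteq> C"
  shows "I \<subseteq> bpos_part N"
proof
  fix a assume a: "a \<in> I"
  then have aC: "a \<in> C"
    by (rule ideal_closed[OF I(1)])
  have "a \<notin> units"
  proof
    assume "a \<in> units"
    then obtain b where b: "b \<in> C" "a \<oplus> b = \<zero>"
      unfolding bunits_def by blast
    then have "\<zero> \<in> I"
      using ideal_plus[OF I(1) a] by metis
    then have "c \<in> I" if "c \<in> C" for c
      using ideal_plus[OF I(1) _ that, of \<zero>] that by simp
    then show False
      using I ideal_closed by blast
  qed
  then show "a \<in> bpos_part N"
    using aC unfolding bpos_part_def by simp
qed

lemma nonunits_prime: "prime_ideal N (bpos_part N)"
proof -
  have "bideal N (bpos_part N)"
  proof (rule idealI)
    have "\<infinity> \<in> bpos_part N"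
      unfolding bpos_part_def by simp
    then show "bpos_part N \<noteq> {}"
      by blast
  qed (auto simp: bpos_part_def plus_unit_iff)
  moreover have "bpos_part N \<noteq> C"
    using zero_closed zero_unit unfolding bpos_part_def by blast
  ultimately show ?thesis
    unfolding prime_ideal_def by (simp add: bpos_part_def plus_unit_iff)
qed

text \<open>The ascending chain condition, oriented so that induction may assume the claim for
  larger ideals. The union of a chain is a finitely generated ideal, and its generators already lie
  in one member.\<close>

lemma wf_ideals: "wf {(J', J). bideal N J \<and> bideal N J' \<and> J \<subset> J'}"
proof (rule ccontr)
  assume "\<not> wf {(J', J). bideal N J \<and> bideal N J' \<and> J \<subset> J'}"
  then obtain J where "\<forall>i. (J (Suc i), J i) \<in> {(J', J). bideal N J \<and> bideal N J' \<and> J \<subset> J'}"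
    unfolding wf_iff_no_infinite_down_chain by blast
  then have J: "\<And>i. bideal N (J i)" "\<And>i. J i \<subset> J (Suc i)"
    by simp_all
  have mono: "J i \<subseteq> J j" if "i \<le> j" for i j
    using lift_Suc_mono_le[of J] J(2) that by blast
  define U where "U = (\<Union>i. J i)"
  have "bideal N U"
  proof (rule idealI)
    show "U \<noteq> {}"
      using ideal_inf[OF J(1)] unfolding U_def by blast
    show "U \<subseteq> C"
      using ideal_closed[OF J(1)] unfolding U_def by blast
    show "a \<oplus> c \<in> U" if "a \<in> U" "c \<in> C" for a c
      using ideal_plus[OF J(1)] that unfolding U_def by blast
  qed
  from ideal_fg[OF this] obtain T where
    T: "T \<subseteq> U" "finite T" "\<forall>u\<in>U. \<exists>t\<in>T. \<exists>c\<in>C. u = t \<oplus> c"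
    by (elim exE conjE)
  have "\<forall>t\<in>T. \<exists>i. t \<in> J i"
    using T(1) unfolding U_def by blast
  then obtain i where i: "\<And>t. t \<in> T \<Longrightarrow> t \<in> J (i t)"
    by metis
  define m where "m = Max (i ` T)"
  have Tm: "t \<in> J m" if "t \<in> T" for t
    using i[OF that] mono[of "i t" m] T(2) that unfolding m_def by auto
  have "U \<subseteq> J m"
  proof
    fix u assume "u \<in> U"
    from T(3)[rule_format, OF this] obtain t c where "t \<in> T" "c \<in> C" "u = t \<oplus> c"
      by (elim bexE)
    then show "u \<in> J m"
      using ideal_plus[OF J(1) Tm] by simp
  qed
  then show False
    using J(2)[of m] unfolding U_def by blast
qed

text \<open>Primes above \<open>J\<close> correspond to primes of the residue class binoid
  \<open>N/J\<close>, so bounds on such \<open>k\<close> are bounds on its dimension, expressed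
  without forming quotients.\<close>

definition prime_chain :: "'a set \<Rightarrow> nat \<Rightarrow> bool" where
  "prime_chain J k \<longleftrightarrow>
    (\<exists>P. (\<forall>i\<le>k. prime_ideal N (P i)) \<and> (\<forall>i<k. P i \<subset> P (Suc i)) \<and> J \<subseteq> P 0)"

lemma prime_chain_mono: "prime_chain J' k \<Longrightarrow> J \<subseteq> J' \<Longrightarrow> prime_chain J k"
  unfolding prime_chain_def by (meson subset_trans)

lemma prime_chain_extend:
  assumes J: "prime_ideal N J" "J \<subset> J'" and "prime_chain J' k"
  shows "prime_chain J (Suc k)"
proof -
  obtain P where P: "\<forall>i\<le>k. prime_ideal N (P i)" "\<forall>i<k. P i \<subset> P (Suc i)" "J' \<subseteq> P 0"
    using assms(3) unfolding prime_chain_def by (elim exE conjE)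
  define Q where "Q i = (case i of 0 \<Rightarrow> J | Suc j \<Rightarrow> P j)" for i
  have "prime_ideal N (Q i)" if "i \<le> Suc k" for i
    using P(1) J(1) that unfolding Q_def by (cases i) simp_all
  moreover have "Q i \<subset> Q (Suc i)" if "i < Suc k" for i
    using P(2,3) J(2) that unfolding Q_def by (cases i) auto
  moreover have "J \<subseteq> Q 0"
    unfolding Q_def by simp
  ultimately show ?thesis
    unfolding prime_chain_def by (intro exI[of _ Q]) simp
qed

lemma finite_outside_frob: "q \<ge> 1 \<Longrightarrow> finite (C - frob q)"
  using rational_HKF by blast

lemma frob_translate:
  assumes "c \<in> C" "y \<in> C" "c \<oplus> y \<notin> frob q"
  shows "y \<notin> frob q"
  using assms frob_plus[of y q c] plus_comm[of c y] by auto

text \<open>Below a prime \<open>J\<close> one peels off multiples of some nonunit \<open>g\<close> outside \<open>J\<close>: outside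
  \<open>frob q\<close> at most linearly many (in \<open>q\<close>) of them fit, and the remainder avoids the larger ideal
  generated by \<open>J\<close> and \<open>g\<close>, all of whose chains of primes can be extended downwards by \<open>J\<close>.\<close>

lemma card_outside_frob_prime_step:
  assumes J: "bideal N J" and g: "g \<in> C" "k \<cdot> g \<in> n" and q: "q \<ge> 1"
    and J': "J' = J \<union> {g \<oplus> c | c. c \<in> C}"
  shows "card (C - frob q - J) \<le> (k * q) * card (C - frob q - J')"
proof -
  let ?f = "\<lambda>(i, b). (i \<cdot> g) \<oplus> b"
  have fin: "finite (C - frob q - J')"
    using finite_outside_frob[OF q] by simp
  have "C - frob q - J \<subseteq> ?f ` ({..<k * q} \<times> (C - frob q - J'))"
  proof
    fix a assume a: "a \<in> C - frob q - J"
    \<comment> \<open>All multiplicities of \<open>g\<close> that split off from \<open>a\<close>.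
      The largest one leaves a remainder that is not a translate of \<open>g\<close>, while
      \<open>q * k\<close> copies of \<open>g\<close> would put \<open>a\<close> into
      \<open>frob q\<close>.\<close>
    define I where "I = {i. \<exists>b\<in>C. a = (i \<cdot> g) \<oplus> b}"
    have less: "i < k * q" if i: "i \<in> I" for i
    proof (rule ccontr)
      assume "\<not> i < k * q"
      then obtain j where j: "i = q * k + j"
        by (metis le_add_diff_inverse mult.commute not_less)
      obtain b where b: "b \<in> C" "a = (i \<cdot> g) \<oplus> b"
        using i unfolding I_def by blast
      then have "a = (q \<cdot> k \<cdot> g) \<oplus> ((j \<cdot> g) \<oplus> b)"
        using g(1) unfolding j by (simp add: mul_add mul_mul plus_assoc)
      then show False
        using frobI[OF g(2), of "(j \<cdot> g) \<oplus> b" q] a b(1) g(1) by simp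
    qed
    have finI: "finite I"
      by (rule finite_subset[of _ "{..<k * q}"]) (use less in auto)
    have "0 \<in> I"
      using a unfolding I_def by (auto intro!: bexI[of _ a])
    define i where "i = Max I"
    have "i \<in> I"
      unfolding i_def using finI \<open>0 \<in> I\<close> by (intro Max_in) auto
    then obtain b where b: "b \<in> C" "a = (i \<cdot> g) \<oplus> b"
      unfolding I_def by blast
    have "b \<notin> J"
      using ideal_plus'[OF J, of b "i \<cdot> g"] a b g(1) by auto
    moreover have "b \<noteq> g \<oplus> c" if "c \<in> C" for c
    proof
      assume "b = g \<oplus> c"
      then have "a = (Suc i \<cdot> g) \<oplus> c"
        using b that g(1) by (simp add: mul_Suc plus_ac)
      then have "Suc i \<in> I"
        using that unfolding I_def by blast
      then show False
        using Max_ge[OF finI] unfolding i_def by (meson Suc_n_not_le_n)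
    qed
    ultimately have "b \<notin> J'"
      unfolding J' by blast
    moreover have "b \<notin> frob q"
      using frob_translate[of "i \<cdot> g" b q] a b g(1) by simp
    ultimately show "a \<in> ?f ` ({..<k * q} \<times> (C - frob q - J'))"
      using b less[OF \<open>i \<in> I\<close>] by (intro image_eqI[of _ _ "(i, b)"]) simp_all
  qed
  then have "card (C - frob q - J) \<le> card (?f ` ({..<k * q} \<times> (C - frob q - J')))"
    using fin by (intro card_mono) auto
  also have "\<dots> \<le> card ({..<k * q} \<times> (C - frob q - J'))"
    using fin by (intro card_image_le) simp
  finally show ?thesis
    by (simp add: card_cartesian_product)
qed

text \<open>\<open>J2\<close> is the colon ideal of \<open>J\<close> by \<open>a\<close>. An element
  of \<open>J1\<close> outside \<open>J\<close> is \<open>a + y\<close> with \<open>y\<close>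
  outside \<open>J2\<close>, so \<open>N/J\<close> is counted by \<open>N/J1\<close> and the image
  of \<open>N/J2\<close> under adding \<open>a\<close>.\<close>

lemma card_outside_frob_nonprime_step:
  assumes J: "bideal N J" and a: "a \<in> C" and q: "q \<ge> 1"
    and J1: "J1 = J \<union> {a \<oplus> c | c. c \<in> C}" and J2: "J2 = {y \<in> C. a \<oplus> y \<in> J}"
  shows "card (C - frob q - J) \<le> card (C - frob q - J1) + card (C - frob q - J2)"
proof -
  have "C - frob q - J \<subseteq> (C - frob q - J1) \<union> (\<lambda>y. a \<oplus> y) ` (C - frob q - J2)"
  proof
    fix x assume x: "x \<in> C - frob q - J"
    show "x \<in> (C - frob q - J1) \<union> (\<lambda>y. a \<oplus> y) ` (C - frob q - J2)"
    proof (cases "x \<in> J1")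
      case True
      then obtain y where y: "y \<in> C" "x = a \<oplus> y"
        using x unfolding J1 by blast
      then have "y \<in> C - frob q - J2"
        using x frob_translate[OF a y(1)] unfolding J2 by simp
      then show ?thesis
        using y(2) by blast
    qed (use x in simp)
  qed
  then have "card (C - frob q - J) \<le> card ((C - frob q - J1) \<union> (\<lambda>y. a \<oplus> y) ` (C - frob q - J2))"
    using finite_outside_frob[OF q] by (intro card_mono) simp_all
  also have "\<dots> \<le> card (C - frob q - J1) + card ((\<lambda>y. a \<oplus> y) ` (C - frob q - J2))"
    by (rule card_Un_le)
  also have "card ((\<lambda>y. a \<oplus> y) ` (C - frob q - J2)) \<le> card (C - frob q - J2)"
    using finite_outside_frob[OF q] by (intro card_image_le) simp
  finally show ?thesis by simp
qed

lemma ideal_adjoin: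
  assumes J: "bideal N J" and g: "g \<in> C"
  shows "bideal N (J \<union> {g \<oplus> c | c. c \<in> C})"
proof (rule idealI)
  show "J \<union> {g \<oplus> c | c. c \<in> C} \<noteq> {}"
    using ideal_inf[OF J] by blast
  show "J \<union> {g \<oplus> c | c. c \<in> C} \<subseteq> C"
    using ideal_closed[OF J] g by auto
  fix x c assume x: "x \<in> J \<union> {g \<oplus> c | c. c \<in> C}" and c: "c \<in> C"
  show "x \<oplus> c \<in> J \<union> {g \<oplus> c | c. c \<in> C}"
  proof (cases "x \<in> J")
    case True
    then show ?thesis
      using ideal_plus[OF J _ c] by simp
  next
    case False
    then obtain d where d: "d \<in> C" "x = g \<oplus> d"
      using x by blast
    then have "x \<oplus> c = g \<oplus> (d \<oplus> c)"
      using g c by (simp add: plus_assoc)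
    then show ?thesis
      using d(1) c plus_closed by blast
  qed
qed

lemma ideal_colon:
  assumes J: "bideal N J" and a: "a \<in> C"
  shows "bideal N {y \<in> C. a \<oplus> y \<in> J}"
proof (rule idealI)
  have "\<infinity> \<in> {y \<in> C. a \<oplus> y \<in> J}"
    using ideal_inf[OF J] a by simp
  then show "{y \<in> C. a \<oplus> y \<in> J} \<noteq> {}"
    by blast
  fix y c assume y: "y \<in> {y \<in> C. a \<oplus> y \<in> J}" and c: "c \<in> C"
  then have "(a \<oplus> y) \<oplus> c \<in> J"
    using ideal_plus[OF J _ c] by simp
  then show "y \<oplus> c \<in> {y \<in> C. a \<oplus> y \<in> J}"
    using y c a by (simp add: plus_assoc)
qed auto

text \<open>The exponent is any bound on chains of primes above \<open>J\<close>, so it passes to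
  larger ideals. A nonprime \<open>J\<close> is replaced by two larger ideals with the same
  \<open>d\<close>; a prime properly inside the nonunits costs a factor linear in \<open>q\<close>
  but lowers \<open>d\<close> by one; for the ideal of all nonunits only the finitely many units
  remain.\<close>

lemma card_outside_frob_bound:
  assumes "bideal N J" and "\<And>k. prime_chain J k \<Longrightarrow> k \<le> d"
  shows "\<exists>K. \<forall>q\<ge>1. card (C - frob q - J) \<le> K * q ^ d"
  using assms
proof (induction J arbitrary: d rule: wf_induct_rule[OF wf_ideals])
  case (1 J)
  note J = "1.prems"(1) and chains = "1.prems"(2)
  have IH: "\<exists>K. \<forall>q\<ge>1. card (C - frob q - J') \<le> K * q ^ d'"
    if "bideal N J'" "J \<subset> J'" "\<And>k. prime_chain J' k \<Longrightarrow> k \<le> d'" for J' d'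
    using "1.IH"[of J' d'] that J by simp
  have adjoin: "J \<subset> J \<union> {g \<oplus> c | c. c \<in> C}" if "g \<in> C - J" for g
  proof -
    have "g = g \<oplus> \<zero>"
      using that by simp
    then have "g \<in> J \<union> {g \<oplus> c | c. c \<in> C}"
      using zero_closed by blast
    then show ?thesis
      using that by blast
  qed
  consider "J = C" | "prime_ideal N J" | "J \<noteq> C" "\<not> prime_ideal N J"
    by blast
  then show ?case
  proof cases
    case 1
    then have "card (C - frob q - J) \<le> 0 * q ^ d" for q
      by (simp add: Diff_eq)
    then show ?thesis
      by (intro exI[of _ 0]) simp
  next
    case 2
    then have sub: "J \<subseteq> bpos_part N"
      using proper_ideal_nonunits[OF J] unfolding prime_ideal_def by blast
    show ?thesis
    proof (cases "J = bpos_part N")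
      case True
      have "card (C - frob q - J) \<le> card units * q ^ d" if "q \<ge> 1" for q
      proof -
        have "card (C - frob q - J) \<le> card units"
          unfolding True by (intro card_mono finite_units) (auto simp: bpos_part_def)
        also have "\<dots> \<le> card units * q ^ d"
          using that by simp
        finally show ?thesis .
      qed
      then show ?thesis by blast
    next
      case False
      then obtain g where g: "g \<in> bpos_part N" "g \<notin> J"
        using sub by blast
      then have gC: "g \<in> C"
        unfolding bpos_part_def by simp
      obtain k where k: "k \<cdot> g \<in> n"
        using n_primary[OF g(1)] by blast
      define J' where "J' = J \<union> {g \<oplus> c | c. c \<in> C}"
      have J': "bideal N J'" "J \<subset> J'"
        unfolding J'_def using ideal_adjoin[OF J gC] adjoin gC g(2) by simp_all
      \<comment> \<open>The chain from \<open>J\<close> to the nonunits shows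
        \<open>d \<ge> 1\<close>, so that \<open>d - 1\<close> below is not truncated.\<close>
      have "prime_chain (bpos_part N) 0"
        unfolding prime_chain_def by (intro exI[of _ "\<lambda>_. bpos_part N"]) (simp add: nonunits_prime)
      then have "prime_chain J (Suc 0)"
        using prime_chain_extend[OF 2] sub False by blast
      then have "d \<ge> 1"
        using chains by fastforce
      have "k' \<le> d - 1" if "prime_chain J' k'" for k'
        using chains[OF prime_chain_extend[OF 2 J'(2) that]] by simp
      then obtain K where K: "\<forall>q\<ge>1. card (C - frob q - J') \<le> K * q ^ (d - 1)"
        using IH[OF J'] by blast
      have "card (C - frob q - J) \<le> (k * K) * q ^ d" if "q \<ge> 1" for q
      proof -
        have "card (C - frob q - J) \<le> (k * q) * card (C - frob q - J')"
          by (rule card_outside_frob_prime_step[OF J gC k that J'_def])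
        also have "\<dots> \<le> (k * q) * (K * q ^ (d - 1))"
          using K that by (intro mult_le_mono2) simp
        also have "\<dots> = (k * K) * (q * q ^ (d - 1))"
          by (simp add: mult_ac)
        also have "q * q ^ (d - 1) = q ^ d"
          using \<open>d \<ge> 1\<close> by (simp flip: power_Suc)
        finally show ?thesis .
      qed
      then show ?thesis by blast
    qed
  next
    case 3
    \<comment> \<open>Both new ideals are strictly larger than \<open>J\<close>: \<open>a\<close>
      enters \<open>J1\<close> and \<open>b\<close> enters \<open>J2\<close>.\<close>
    then obtain a b where ab: "a \<in> C - J" "b \<in> C - J" "a \<oplus> b \<in> J"
      using J unfolding prime_ideal_def by blast
    define J1 where "J1 = J \<union> {a \<oplus> c | c. c \<in> C}"
    define J2 where "J2 = {y \<in> C. a \<oplus> y \<in> J}"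
    have aC: "a \<in> C"
      using ab by simp
    have J1: "bideal N J1" "J \<subset> J1"
      unfolding J1_def using ideal_adjoin[OF J aC] adjoin[OF ab(1)] by simp_all
    have J2: "bideal N J2"
      unfolding J2_def by (rule ideal_colon[OF J aC])
    have "J \<subseteq> J2"
      unfolding J2_def using ideal_plus'[OF J _ aC] ideal_closed[OF J] by blast
    moreover have "b \<in> J2"
      using ab unfolding J2_def by simp
    ultimately have J2': "J \<subset> J2"
      using ab(2) by blast
    obtain K1 where K1: "\<forall>q\<ge>1. card (C - frob q - J1) \<le> K1 * q ^ d"
      using IH[OF J1, of d] chains prime_chain_mono[of J1 _ J] J1(2) by blast
    obtain K2 where K2: "\<forall>q\<ge>1. card (C - frob q - J2) \<le> K2 * q ^ d"
      using IH[OF J2 J2', of d] chains prime_chain_mono[of J2 _ J] J2' by blast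
    have "card (C - frob q - J) \<le> (K1 + K2) * q ^ d" if q: "q \<ge> 1" for q
    proof -
      have "card (C - frob q - J) \<le> card (C - frob q - J1) + card (C - frob q - J2)"
        by (rule card_outside_frob_nonprime_step[OF J aC q J1_def J2_def])
      also have "\<dots> \<le> K1 * q ^ d + K2 * q ^ d"
        using K1 K2 q by (intro add_mono) simp_all
      finally show ?thesis
        by (simp add: algebra_simps)
    qed
    then show ?thesis by blast
  qed
qed

section \<open>Finiteness of the dimension\<close>

lemma prime_contains_generator:
  assumes P: "prime_ideal N P" and w: "set_mset w \<subseteq> G" "T.msum.F w \<in> P"
  shows "\<exists>g\<in>P. g \<in># w"
  using w
proof (induction w)
  case empty
  then show ?case
    using P proper_ideal_nonunits[of P] unfolding prime_ideal_def bpos_part_def by auto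
next
  case (add g w)
  have "T.msum.F w \<in> C" "g \<in> C"
    using add.prems(1) G(2) by (auto intro!: msum_closed)
  then have "g \<oplus> T.msum.F w \<in> P"
    using add.prems(2) by simp
  then have "g \<in> P \<or> T.msum.F w \<in> P"
    using P \<open>g \<in> C\<close> \<open>T.msum.F w \<in> C\<close> unfolding prime_ideal_def by blast
  then show ?case
    using add by auto
qed

text \<open>A prime that contains a sum of generators contains one of them, so it is determined by
  its trace on the finite set \<open>G\<close>.\<close>

lemma finite_primes: "finite {P. prime_ideal N P}"
proof -
  have sub: "P \<subseteq> Q" if P: "prime_ideal N P" and Q: "prime_ideal N Q" and PQ: "P \<inter> G = Q \<inter> G" for P Q
  proof
    fix x assume x: "x \<in> P"
    have QI: "bideal N Q" and PI: "bideal N P"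
      using P Q unfolding prime_ideal_def by simp_all
    have "x \<in> T.gen G"
      using ideal_closed[OF PI x] gen_G by simp
    then obtain w where w: "set_mset w \<subseteq> G" "x = T.msum.F w"
      by (rule T.genE)
    have "\<exists>g\<in>P. g \<in># w"
      by (rule prime_contains_generator[OF P w(1)]) (use x w(2) in simp)
    then obtain g where g: "g \<in> P" "g \<in># w"
      by (elim bexE)
    have "g \<in> P \<inter> G"
      by (rule IntI[OF g(1) subsetD[OF w(1) g(2)]])
    then have gQ: "g \<in> Q"
      unfolding PQ by simp
    obtain v where v: "w = add_mset g v"
      using multi_member_split[OF g(2)] by (elim exE)
    have "set_mset v \<subseteq> G"
      using w(1) unfolding v by simp
    then have "T.msum.F v \<in> C"
      by (intro msum_closed subset_trans[OF _ G(2)])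
    then have "g \<oplus> T.msum.F v \<in> Q" and "x = g \<oplus> T.msum.F v"
      using ideal_plus[OF QI gQ] ideal_closed[OF QI gQ] w(2) unfolding v by simp_all
    then show "x \<in> Q"
      by simp
  qed
  have inj: "inj_on (\<lambda>P. P \<inter> G) {P. prime_ideal N P}"
  proof (rule inj_onI)
    fix P Q assume "P \<in> {P. prime_ideal N P}" "Q \<in> {P. prime_ideal N P}" and eq: "P \<inter> G = Q \<inter> G"
    then have P: "prime_ideal N P" and Q: "prime_ideal N Q"
      by simp_all
    show "P = Q"
      by (rule subset_antisym[OF sub[OF P Q eq] sub[OF Q P eq[symmetric]]])
  qed
  have "finite ((\<lambda>P. P \<inter> G) ` {P. prime_ideal N P})"
    by (rule finite_subset[of _ "Pow G"]) (use G(1) in auto)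
  then show ?thesis
    by (rule finite_imageD[OF _ inj])
qed

text \<open>A chain of length \<open>k\<close> has \<open>k + 1\<close> distinct members, so the
  number of primes bounds the supremum, which is therefore a natural number. It supplies the
  exponent for the growth bound at the ideal \<open>{\<infinity>}\<close>.\<close>

lemma bdim_bound:
  "\<exists>d. bdim N = enat d \<and> (\<forall>k. prime_chain {\<infinity>} k \<longrightarrow> k \<le> d)"
proof -
  let ?S = "{enat k | k. \<exists>P :: nat \<Rightarrow> 'a set.
       (\<forall>i\<le>k. prime_ideal N (P i)) \<and> (\<forall>i<k. P i \<subset> P (Suc i))}"
  have "x \<le> enat (card {P. prime_ideal N P})" if "x \<in> ?S" for x
  proof -
    from that obtain k P where x: "x = enat k" and
      P: "\<forall>i\<le>k. prime_ideal N (P i)" "\<forall>i<k. P i \<subset> P (Suc i)"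
      by (elim CollectE exE conjE)
    have less: "P i \<subset> P j" if "i < j" "j \<le> k" for i j
      using that
    proof (induction j)
      case (Suc j)
      have "P j \<subset> P (Suc j)"
        using P(2) Suc.prems(2) by simp
      moreover have "i = j \<or> P i \<subset> P j"
        using Suc.IH Suc.prems by linarith
      ultimately show ?case
        by (metis psubset_trans)
    qed simp
    have "inj_on P {..k}"
    proof (rule inj_onI)
      fix i j assume "i \<in> {..k}" "j \<in> {..k}" "P i = P j"
      then show "i = j"
        using less[of i j] less[of j i] by (metis atMost_iff linorder_neqE_nat psubset_eq)
    qed
    moreover have "P ` {..k} \<subseteq> {P. prime_ideal N P}"
      using P(1) by auto
    ultimately have "card {..k} \<le> card {P. prime_ideal N P}"
      using finite_primes by (intro card_inj_on_le)
    then show ?thesis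
      unfolding x by simp
  qed
  then have "bdim N \<le> enat (card {P. prime_ideal N P})"
    unfolding bdim_def by (intro Sup_least)
  then obtain d where d: "bdim N = enat d"
    by (cases "bdim N") auto
  have "k \<le> d" if "prime_chain {\<infinity>} k" for k
  proof -
    from that obtain P where
      "\<forall>i\<le>k. prime_ideal N (P i)" "\<forall>i<k. P i \<subset> P (Suc i)"
      unfolding prime_chain_def by (elim exE conjE)
    then have "enat k \<in> ?S"
      by (intro CollectI exI[of _ k] exI[of _ P] conjI refl)
    then have "enat k \<le> bdim N"
      unfolding bdim_def by (rule Sup_upper)
    then show ?thesis
      unfolding d by simp
  qed
  then show ?thesis
    by (intro exI[of _ d] conjI d allI impI)
qed

lemma HKF_mono:
  assumes "1 \<le> i" "i \<le> j"
  shows "HKF N n i \<le> HKF N n j"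
  using assms(2)
proof (induction j rule: dec_induct)
  case (step j)
  have "card (C - frob j) \<le> card (C - frob (Suc j))"
    using frob_antimono[of j] finite_outside_frob[of "Suc j"] by (intro card_mono) auto
  then show ?case
    using step.IH unfolding HKF_eq by simp
qed simp

end

text \<open>Monotonicity squeezes \<open>h q\<close> between the values at
  \<open>m * (q div m)\<close> and \<open>m * Suc (q div m)\<close>. Since
  \<open>(q div m) / q\<close> tends to \<open>1 / m\<close>, both bounds have the same limit after
  division by \<open>q ^ d\<close>.\<close>

lemma limit_from_section:
  fixes h :: "nat \<Rightarrow> nat"
  assumes mono: "\<And>i j. 1 \<le> i \<Longrightarrow> i \<le> j \<Longrightarrow> h i \<le> h j" and m: "m \<ge> 1"
    and lim: "(\<lambda>k. real (h (m * k)) / real k ^ d) \<longlonglongrightarrow> e"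
  shows "(\<lambda>q. real (h q) / real q ^ d) \<longlonglongrightarrow> e / real m ^ d"
proof (rule tendsto_sandwich)
  define g where "g k = real (h (m * k)) / real k ^ d" for k
  have g: "g \<longlonglongrightarrow> e"
    using lim unfolding g_def .
  have div: "filterlim (\<lambda>q. q div m) sequentially sequentially"
    unfolding filterlim_at_top
  proof
    fix Z :: nat
    show "\<forall>\<^sub>F q in sequentially. Z \<le> q div m"
      using m by (intro eventually_sequentiallyI[of "Z * m"]) (simp add: less_eq_div_iff_mult_less_eq)
  qed
  have quot: "(\<lambda>q. real (q div m) / real q) \<longlonglongrightarrow> 1 / real m"
  proof (rule tendsto_sandwich)
    show "\<forall>\<^sub>F q in sequentially. 1 / real m - 1 / real q \<le> real (q div m) / real q"
    proof (rule eventually_sequentiallyI[of 1])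
      fix q :: nat assume q: "1 \<le> q"
      have "real q / real m - 1 \<le> real (q div m)"
      proof -
        have "real q \<le> real (m + m * (q div m))"
          using m dividend_less_times_div[of m q] by (intro of_nat_mono) simp
        then show ?thesis
          using m by (simp add: field_simps)
      qed
      then have "(real q / real m - 1) / real q \<le> real (q div m) / real q"
        by (rule divide_right_mono) simp
      then show "1 / real m - 1 / real q \<le> real (q div m) / real q"
        using q by (simp add: diff_divide_distrib)
    qed
    show "\<forall>\<^sub>F q in sequentially. real (q div m) / real q \<le> 1 / real m"
    proof (rule eventually_sequentiallyI[of 1])
      fix q :: nat assume q: "1 \<le> q"
      have "real (q div m) / real q \<le> (real q / real m) / real q"
      proof (intro divide_right_mono)
        have "real (m * (q div m)) \<le> real q"
          by (intro of_nat_mono) simp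
        then show "real (q div m) \<le> real q / real m"
          using m by (simp add: field_simps)
      qed simp
      then show "real (q div m) / real q \<le> 1 / real m"
        using q by simp
    qed
    show "(\<lambda>q. 1 / real m - 1 / real q) \<longlonglongrightarrow> 1 / real m"
      using tendsto_diff[OF tendsto_const lim_const_over_n[of 1]] by simp
  qed simp
  have quot': "(\<lambda>q. real (Suc (q div m)) / real q) \<longlonglongrightarrow> 1 / real m"
    using tendsto_add[OF quot lim_const_over_n[of 1]] by (simp add: add_divide_distrib add.commute)
  show "(\<lambda>q. g (q div m) * (real (q div m) / real q) ^ d) \<longlonglongrightarrow> e / real m ^ d"
    using tendsto_mult[OF filterlim_compose[OF g div] tendsto_power[OF quot, of d]]
    by (simp add: power_one_over)
  show "(\<lambda>q. g (Suc (q div m)) * (real (Suc (q div m)) / real q) ^ d) \<longlonglongrightarrow> e / real m ^ d"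
    using tendsto_mult[OF filterlim_compose[OF LIMSEQ_Suc[OF g] div] tendsto_power[OF quot', of d]]
    by (simp add: power_one_over)
  show "\<forall>\<^sub>F q in sequentially. g (q div m) * (real (q div m) / real q) ^ d \<le> real (h q) / real q ^ d"
  proof (rule eventually_sequentiallyI[of m])
    \<comment> \<open>For smaller \<open>q\<close> the lower multiple of \<open>m\<close> would be
      0, which \<open>mono\<close> does not cover.\<close>
    fix q :: nat assume q: "m \<le> q"
    then have pos: "q div m \<ge> 1"
      using m by (simp add: Suc_le_eq div_greater_zero_iff)
    then have "h (m * (q div m)) \<le> h q"
      using m by (intro mono) simp_all
    then show "g (q div m) * (real (q div m) / real q) ^ d \<le> real (h q) / real q ^ d"
      using pos unfolding g_def by (simp add: power_divide divide_right_mono)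
  qed
  show "\<forall>\<^sub>F q in sequentially. real (h q) / real q ^ d \<le> g (Suc (q div m)) * (real (Suc (q div m)) / real q) ^ d"
  proof (rule eventually_sequentiallyI[of 1])
    fix q :: nat assume q: "1 \<le> q"
    have "q \<le> m * Suc (q div m)"
      using m dividend_less_times_div[of m q] by simp
    then have "h q \<le> h (m * Suc (q div m))"
      using q by (intro mono)
    then show "real (h q) / real q ^ d \<le> g (Suc (q div m)) * (real (Suc (q div m)) / real q) ^ d"
      unfolding g_def by (simp add: power_divide divide_right_mono del: of_nat_Suc)
  qed
qed

theorem mainTheorem1:
  fixes N :: "'a binoid" and n :: "'a set"
  assumes "is_binoid N" and "fin_gen N" and "semipositive N"
    and "cancellative N" and "breduced N" and "primary_ideal N n"
  shows "\<exists>d::nat. \<exists>e::real. bdim N = enat d \<and> e \<in> \<rat> \<and>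
           (\<lambda>q. real (HKF N n q) / real q ^ d) \<longlonglongrightarrow> e"
proof -
  interpret hk_binoid N n
    using assms by unfold_locales
  from bdim_bound obtain d where d: "bdim N = enat d" "\<forall>k. prime_chain {\<infinity>} k \<longrightarrow> k \<le> d"
    by (elim exE conjE)
  \<comment> \<open>The growth bound is applied to the smallest ideal; removing infinity changes
    nothing, as it lies in every \<open>frob q\<close>.\<close>
  have "bideal N {\<infinity>}"
    by (rule idealI) auto
  then have "\<exists>K. \<forall>q\<ge>1. card (C - frob q - {\<infinity>}) \<le> K * q ^ d"
    by (rule card_outside_frob_bound) (use d(2) in simp)
  then obtain K where K: "\<forall>q\<ge>1. card (C - frob q - {\<infinity>}) \<le> K * q ^ d"
    by (elim exE)
  from rational_HKF obtain h where
    h: "rational_gf (Abs_fps (\<lambda>q. int (h q)))" "\<forall>q\<ge>1. h q = HKF N n q \<and> finite (C - frob q)"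
    by (elim exE conjE)
  have bound: "real (h q) \<le> real K * real q ^ d" if "q \<ge> 1" for q
  proof -
    have "C - frob q - {\<infinity>} = C - frob q"
      using inf_in_frob by simp
    then have "h q \<le> K * q ^ d"
      using K[rule_format, OF that] h(2)[rule_format, OF that] by (simp add: HKF_eq)
    then have "real (h q) \<le> real (K * q ^ d)"
      by (rule of_nat_mono)
    then show ?thesis
      by simp
  qed
  have "\<exists>m\<ge>1. \<exists>e\<in>\<rat>. (\<lambda>k. real (h (m * k)) / real k ^ d) \<longlonglongrightarrow> e"
    by (rule rational_gf_section_limit[OF h(1)]) (rule bound)
  then obtain m e where
    m: "m \<ge> 1" "e \<in> \<rat>" "(\<lambda>k. real (h (m * k)) / real k ^ d) \<longlonglongrightarrow> e"
    by (elim exE conjE bexE)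
  \<comment> \<open>\<open>e\<close> measures \<open>h (m * k)\<close> against \<open>k ^ d\<close>;
    against \<open>(m * k) ^ d\<close> it becomes \<open>e / m ^ d\<close>, which is still
    rational.\<close>
  have "(\<lambda>q. real (h q) / real q ^ d) \<longlonglongrightarrow> e / real m ^ d"
  proof (rule limit_from_section[OF _ m(1,3)])
    show "h i \<le> h j" if "1 \<le> i" "i \<le> j" for i j
      using h(2)[rule_format, of i] h(2)[rule_format, of j] HKF_mono[OF that] that by simp
  qed
  moreover have "\<forall>\<^sub>F q in sequentially. real (h q) / real q ^ d = real (HKF N n q) / real q ^ d"
    using h(2) by (intro eventually_sequentiallyI[of 1]) simp
  ultimately have "(\<lambda>q. real (HKF N n q) / real q ^ d) \<longlonglongrightarrow> e / real m ^ d"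
    by (rule Lim_transform_eventually)
  moreover have "e / real m ^ d \<in> \<rat>"
    using m(2) by (intro Rats_divide Rats_power) simp_all
  ultimately show ?thesis
    using d(1) by (intro exI[of _ d] exI[of _ "e / real m ^ d"] conjI)
qed

end
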